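(* \textsf{eFrege}$+\forall$-Red simulates \textsf{LQU}$^+$\textsf{-Res}: there is a polynomial $P$ such that for every closed PCNF QBF $\Pi\phi$ and every \textsf{LQU}$^+$\textsf{-Res} refutation $\pi$ of $\Pi\phi$ there is an \textsf{eFrege}$+\forall$-Red refutation of $\Pi\phi$ of size at most $P(|\pi|)$.
   Context: A closed PCNF QBF is $\Pi\phi$ with $\Pi$ a linear quantifier prefix over all variables of the CNF $\phi$; $\mathrm{lev}(v)$ (also written $\mathrm{ind}(v)$) is the position of $v$ in $\Pi$. \textsf{eFrege}$+\forall$-Red: lines are propositional formulas; it has the rules of a Frege system (a fixed finite sound and implicationally complete set of propositional axiom and rule schemata), the extension rule (introduce $v\leftrightarrow f$ for a fresh variable $v$, placed in the prefix as an existential variable right of the variables of $f$), and the reduction rule: from $F$ containing universal $u$ such that no variable of $F$ is right of $u$ in the prefix, derive $F[u/0]$ or $F[u/1]$. A refutation derives $\bot$ from the clauses of $\phi$. \textsf{LQU}$^+$\textsf{-Res}: clauses may contain ordinary literals and merged literals $u^*$ for universal $u$. Axiom: any clause of $\phi$. $\forall$-Red: from $D\cup\{u\}$ with $u$ a universal literal and $\mathrm{lev}(u)\ge\mathrm{lev}(l)$ for all $l\in D$, derive $D$; $\forall$-Red$^*$: likewise from $D\cup\{u^*\}$ derive $D$. Resolution (pivot $x$ may be existential or universal, never a merged literal): from $C_1\cup U_1\cup\{\neg x\}$ and $C_2\cup U_2\cup\{x\}$ derive $C_1\cup C_2\cup U^*$, in one of two settings. SR: if $z\in C_1$ then $\neg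 z\notin C_2$, and $U_1=U_2=U^*=\emptyset$. LR: if $l_1\in C_1$, $l_2\in C_2$ have the same variable $z$ then $l_1=l_2\ne z^*$; $U_1,U_2$ contain only universal literals with the same set of variables, each of which is right of $x$ ($\mathrm{ind}(x)<\mathrm{ind}(u)$); for $w_1\in U_1,w_2\in U_2$ on the same variable $u$, $w_1=\neg w_2$ or $w_1=u^*$ or $w_2=u^*$; and $U^*=\{u^*: u\text{ a variable of }U_1\}$. A refutation derives the empty clause.
   Formalization: Axioms of LQU+-Res are restricted to non-tautological clauses of φ, and in the SR condition a merged literal u* counts as both u and ¬u (so it clashes with u, ¬u and u* ); without these the calculus refutes true QBFs and the claim fails. *)

theory Defs
  imports "HOL-Computational_Algebra.Polynomial"
begin

section \<open>Closed QBFs in prenex conjunctive normal form\<close>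

type_synonym var = nat

datatype quant = Exists | Forall

type_synonym prefix = "(quant \<times> var) list"

definition pvars :: "prefix \<Rightarrow> var set" where
  "pvars \<Pi> = snd ` set \<Pi>"

definition universal :: "prefix \<Rightarrow> var \<Rightarrow> bool" where
  "universal \<Pi> v \<longleftrightarrow> (Forall, v) \<in> set \<Pi>"

text \<open>The position of a variable in the prefix, counted variable by variable and not by
  quantifier block; \<open>y\<close> is right of \<open>x\<close> iff \<open>lev \<Pi> x < lev \<Pi> y\<close>.\<close>

primrec lev :: "prefix \<Rightarrow> var \<Rightarrow> nat" where
  "lev [] v = 0"
| "lev (p # \<Pi>) v = (if snd p = v then 0 else Suc (lev \<Pi> v))"

datatype lit = Pos var | Neg var

primrec lvar :: "lit \<Rightarrow> var" where
  "lvar (Pos x) = x"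
| "lvar (Neg x) = x"

primrec compl :: "lit \<Rightarrow> lit" where
  "compl (Pos x) = Neg x"
| "compl (Neg x) = Pos x"

type_synonym clause = "lit set"
type_synonym cnf = "clause set"

definition tautological :: "clause \<Rightarrow> bool" where
  "tautological C \<longleftrightarrow> (\<exists>l\<in>C. compl l \<in> C)"

definition closed_pcnf :: "prefix \<Rightarrow> cnf \<Rightarrow> bool" where
  "closed_pcnf \<Pi> \<phi> \<longleftrightarrow>
     distinct (map snd \<Pi>) \<and> finite \<phi> \<and> (\<forall>C\<in>\<phi>. finite C \<and> lvar ` C \<subseteq> pvars \<Pi>)"

section \<open>Propositional formulas and Frege systems\<close>

datatype (vars: 'v) form =
    Var 'v
  | Bot
  | Top
  | Not "'v form"
  | And "'v form" "'v form"
  | Or "'v form" "'v form"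
  | Imp "'v form" "'v form"
  | Iff "'v form" "'v form"

type_synonym fm = "var form"

primrec eval :: "(var \<Rightarrow> bool) \<Rightarrow> fm \<Rightarrow> bool" where
  "eval \<alpha> (Var x) \<longleftrightarrow> \<alpha> x"
| "eval \<alpha> Bot \<longleftrightarrow> False"
| "eval \<alpha> Top \<longleftrightarrow> True"
| "eval \<alpha> (Not A) \<longleftrightarrow> \<not> eval \<alpha> A"
| "eval \<alpha> (And A B) \<longleftrightarrow> eval \<alpha> A \<and> eval \<alpha> B"
| "eval \<alpha> (Or A B) \<longleftrightarrow> eval \<alpha> A \<or> eval \<alpha> B"
| "eval \<alpha> (Imp A B) \<longleftrightarrow> (eval \<alpha> A \<longrightarrow> eval \<alpha> B)"
| "eval \<alpha> (Iff A B) \<longleftrightarrow> (eval \<alpha> A \<longleftrightarrow> eval \<alpha> B)"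

definition entails :: "fm set \<Rightarrow> fm \<Rightarrow> bool" where
  "entails \<Gamma> A \<longleftrightarrow> (\<forall>\<alpha>. (\<forall>G\<in>\<Gamma>. eval \<alpha> G) \<longrightarrow> eval \<alpha> A)"

primrec subst :: "(var \<Rightarrow> fm) \<Rightarrow> fm \<Rightarrow> fm" where
  "subst \<sigma> (Var x) = \<sigma> x"
| "subst \<sigma> Bot = Bot"
| "subst \<sigma> Top = Top"
| "subst \<sigma> (Not A) = Not (subst \<sigma> A)"
| "subst \<sigma> (And A B) = And (subst \<sigma> A) (subst \<sigma> B)"
| "subst \<sigma> (Or A B) = Or (subst \<sigma> A) (subst \<sigma> B)"
| "subst \<sigma> (Imp A B) = Imp (subst \<sigma> A) (subst \<sigma> B)"
| "subst \<sigma> (Iff A B) = Iff (subst \<sigma> A) (subst \<sigma> B)"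

text \<open>The number of symbols, not counting brackets.\<close>

primrec fsize :: "fm \<Rightarrow> nat" where
  "fsize (Var x) = 1"
| "fsize Bot = 1"
| "fsize Top = 1"
| "fsize (Not A) = 1 + fsize A"
| "fsize (And A B) = 1 + fsize A + fsize B"
| "fsize (Or A B) = 1 + fsize A + fsize B"
| "fsize (Imp A B) = 1 + fsize A + fsize B"
| "fsize (Iff A B) = 1 + fsize A + fsize B"

text \<open>A rule schema consists of premises and a conclusion, whose variables are the schematic
  ones; axiom schemata are the rule schemata without premises. An instance is obtained by
  substituting arbitrary formulas for the variables.\<close>

type_synonym frege_rule = "fm list \<times> fm"

inductive frege_derivable :: "frege_rule set \<Rightarrow> fm set \<Rightarrow> fm \<Rightarrow> bool"
  for R :: "frege_rule set" and \<Gamma> :: "fm set" where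
  hyp: "A \<in> \<Gamma> \<Longrightarrow> frege_derivable R \<Gamma> A"
| rule: "(Ps, A) \<in> R \<Longrightarrow> (\<And>B. B \<in> set Ps \<Longrightarrow> frege_derivable R \<Gamma> (subst \<sigma> B))
    \<Longrightarrow> frege_derivable R \<Gamma> (subst \<sigma> A)"

definition frege_system :: "frege_rule set \<Rightarrow> bool" where
  "frege_system R \<longleftrightarrow>
     finite R \<and>
     (\<forall>(Ps, A)\<in>R. entails (set Ps) A) \<and>
     (\<forall>\<Gamma> A. finite \<Gamma> \<longrightarrow> entails \<Gamma> A \<longrightarrow> frege_derivable R \<Gamma> A)"

section \<open>Extended Frege with universal reduction\<close>

primrec lit_fm :: "lit \<Rightarrow> fm" where
  "lit_fm (Pos x) = Var x"
| "lit_fm (Neg x) = Not (Var x)"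

definition disj :: "lit list \<Rightarrow> fm" where
  "disj ls = foldr Or (map lit_fm ls) Bot"

text \<open>\<open>efrege_red R \<Pi> \<phi> \<Pi>' L\<close>: the list \<open>L\<close> of lines is a derivation from \<open>\<Pi> \<phi>\<close>, and \<open>\<Pi>'\<close> is
  \<open>\<Pi>\<close> enlarged by the extension variables of \<open>L\<close>. All lines are formulas over \<open>\<Pi>'\<close>, which is why
  instances of Frege rules may not bring in other variables and why freshness of an extension
  variable only refers to the current prefix. A clause is turned into a formula by listing its
  literals, each of them once, in some order.\<close>

inductive efrege_red ::
  "frege_rule set \<Rightarrow> prefix \<Rightarrow> cnf \<Rightarrow> prefix \<Rightarrow> fm list \<Rightarrow> bool"
  for R :: "frege_rule set" and \<Pi> :: prefix and \<phi> :: cnf where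
  start: "efrege_red R \<Pi> \<phi> \<Pi> []"
| clause: "efrege_red R \<Pi> \<phi> \<Pi>' L \<Longrightarrow> set ls \<in> \<phi> \<Longrightarrow> distinct ls
    \<Longrightarrow> efrege_red R \<Pi> \<phi> \<Pi>' (L @ [disj ls])"
| frege: "efrege_red R \<Pi> \<phi> \<Pi>' L \<Longrightarrow> (Ps, A) \<in> R \<Longrightarrow> \<forall>B\<in>set Ps. subst \<sigma> B \<in> set L
    \<Longrightarrow> vars (subst \<sigma> A) \<subseteq> pvars \<Pi>'
    \<Longrightarrow> efrege_red R \<Pi> \<phi> \<Pi>' (L @ [subst \<sigma> A])"
| extension: "efrege_red R \<Pi> \<phi> (\<Pi>1 @ \<Pi>2) L \<Longrightarrow> v \<notin> pvars (\<Pi>1 @ \<Pi>2)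
    \<Longrightarrow> vars F \<subseteq> pvars \<Pi>1
    \<Longrightarrow> efrege_red R \<Pi> \<phi> (\<Pi>1 @ (Exists, v) # \<Pi>2) (L @ [Iff (Var v) F])"
| reduction: "efrege_red R \<Pi> \<phi> \<Pi>' L \<Longrightarrow> F \<in> set L \<Longrightarrow> universal \<Pi>' u \<Longrightarrow> u \<in> vars F
    \<Longrightarrow> \<forall>x\<in>vars F. \<not> lev \<Pi>' u < lev \<Pi>' x \<Longrightarrow> B \<in> {Bot, Top}
    \<Longrightarrow> efrege_red R \<Pi> \<phi> \<Pi>' (L @ [subst (Var(u := B)) F])"

definition efrege_red_refutation ::
  "frege_rule set \<Rightarrow> prefix \<Rightarrow> cnf \<Rightarrow> fm list \<Rightarrow> bool" where
  "efrege_red_refutation R \<Pi> \<phi> L \<longleftrightarrow> (\<exists>\<Pi>'. efrege_red R \<Pi> \<phi> \<Pi>' L) \<and> Bot \<in> set L"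

definition efrege_size :: "fm list \<Rightarrow> nat" where
  "efrege_size L = (\<Sum>F\<leftarrow>L. fsize F)"

section \<open>The calculus LQU+-Res\<close>

datatype qlit = Ord lit | Merged var

primrec qvar :: "qlit \<Rightarrow> var" where
  "qvar (Ord l) = lvar l"
| "qvar (Merged u) = u"

type_synonym qclause = "qlit set"

text \<open>A merged literal \<open>u*\<close> stands for the pair of literals \<open>u\<close>, \<open>\<not> u\<close>.\<close>

primrec lits_of :: "qlit \<Rightarrow> lit set" where
  "lits_of (Ord l) = {l}"
| "lits_of (Merged u) = {Pos u, Neg u}"

text \<open>In the side condition ``if \<open>z \<in> C1\<close> then \<open>\<not> z \<notin> C2\<close>'', merged literals are read as the
  pairs they stand for, so that \<open>u*\<close> clashes with \<open>u\<close>, \<open>\<not> u\<close> and \<open>u*\<close>. If they were ignored here,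
  the calculus would refute the true QBF with prefix \<open>\<exists>a \<exists>b \<forall>u \<exists>x\<close> and clauses \<open>{a,u,x}\<close>,
  \<open>{\<not>a,\<not>u,x}\<close>, \<open>{b,u,\<not>x}\<close>, \<open>{\<not>b,\<not>u,\<not>x}\<close>.\<close>

definition sr_cond :: "qclause \<Rightarrow> qclause \<Rightarrow> bool" where
  "sr_cond C1 C2 \<longleftrightarrow> (\<forall>z \<in> \<Union>(lits_of ` C1). compl z \<notin> \<Union>(lits_of ` C2))"

definition lr_cond :: "prefix \<Rightarrow> var \<Rightarrow> qclause \<Rightarrow> qclause \<Rightarrow> qclause \<Rightarrow> qclause \<Rightarrow> bool" where
  "lr_cond \<Pi> x C1 U1 C2 U2 \<longleftrightarrow>
     (\<forall>l1\<in>C1. \<forall>l2\<in>C2. \<forall>z. qvar l1 = z \<and> qvar l2 = z \<longrightarrow> l1 = l2 \<and> l2 \<noteq> Merged z) \<and>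
     (\<forall>w\<in>U1 \<union> U2. universal \<Pi> (qvar w)) \<and>
     qvar ` U1 = qvar ` U2 \<and>
     (\<forall>u\<in>qvar ` U1. lev \<Pi> x < lev \<Pi> u) \<and>
     (\<forall>w1\<in>U1. \<forall>w2\<in>U2. \<forall>u. qvar w1 = u \<and> qvar w2 = u \<longrightarrow>
        (\<exists>l. w1 = Ord (compl l) \<and> w2 = Ord l) \<or> w1 = Merged u \<or> w2 = Merged u)"

text \<open>Tautological input clauses are not admitted as axioms, as usual for calculi with universal
  reduction: from the axiom \<open>{u, \<not>u}\<close> two reductions would refute the true QBF \<open>\<forall>u. u \<or> \<not>u\<close>.\<close>

inductive lqu_plus :: "prefix \<Rightarrow> cnf \<Rightarrow> qclause list \<Rightarrow> bool"
  for \<Pi> :: prefix and \<phi> :: cnf where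
  start: "lqu_plus \<Pi> \<phi> []"
| clause: "lqu_plus \<Pi> \<phi> Cs \<Longrightarrow> C \<in> \<phi> \<Longrightarrow> \<not> tautological C
    \<Longrightarrow> lqu_plus \<Pi> \<phi> (Cs @ [Ord ` C])"
| red: "lqu_plus \<Pi> \<phi> Cs \<Longrightarrow> D \<union> {Ord l} \<in> set Cs \<Longrightarrow> universal \<Pi> (lvar l)
    \<Longrightarrow> \<forall>k\<in>D. lev \<Pi> (lvar l) \<ge> lev \<Pi> (qvar k)
    \<Longrightarrow> lqu_plus \<Pi> \<phi> (Cs @ [D])"
| red_merged: "lqu_plus \<Pi> \<phi> Cs \<Longrightarrow> D \<union> {Merged u} \<in> set Cs \<Longrightarrow> universal \<Pi> u
    \<Longrightarrow> \<forall>k\<in>D. lev \<Pi> u \<ge> lev \<Pi> (qvar k)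
    \<Longrightarrow> lqu_plus \<Pi> \<phi> (Cs @ [D])"
| res_sr: "lqu_plus \<Pi> \<phi> Cs
    \<Longrightarrow> C1 \<union> {Ord (Neg x)} \<in> set Cs \<Longrightarrow> C2 \<union> {Ord (Pos x)} \<in> set Cs
    \<Longrightarrow> sr_cond C1 C2
    \<Longrightarrow> lqu_plus \<Pi> \<phi> (Cs @ [C1 \<union> C2])"
| res_lr: "lqu_plus \<Pi> \<phi> Cs
    \<Longrightarrow> C1 \<union> U1 \<union> {Ord (Neg x)} \<in> set Cs \<Longrightarrow> C2 \<union> U2 \<union> {Ord (Pos x)} \<in> set Cs
    \<Longrightarrow> lr_cond \<Pi> x C1 U1 C2 U2
    \<Longrightarrow> lqu_plus \<Pi> \<phi> (Cs @ [C1 \<union> C2 \<union> Merged ` qvar ` U1])"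

definition lqu_plus_refutation :: "prefix \<Rightarrow> cnf \<Rightarrow> qclause list \<Rightarrow> bool" where
  "lqu_plus_refutation \<Pi> \<phi> Cs \<longleftrightarrow> lqu_plus \<Pi> \<phi> Cs \<and> {} \<in> set Cs"

text \<open>The number of literal occurrences, plus one per line so that empty clauses count.\<close>

definition lqu_plus_size :: "qclause list \<Rightarrow> nat" where
  "lqu_plus_size Cs = (\<Sum>C\<leftarrow>Cs. 1 + card C)"

end

(*
  A clause is read as the disjunction of its ordinary literals and of a formula ~ (u <-> V) for each
  merged literal u*, where V is an extension variable placed immediately left of u that records the
  value of u falsifying the two literals merged in u*. A long-distance step with pivot x that merges
  literals falsified by w1 and w2 defines V as (x & w1) | (~ x & w2), which only involves variables
  left of u because x is. Since V is left of u, reducing a merged literal amounts to two reductions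
  u/0 and u/1 followed by propositional reasoning, and every other step of LQU+-Res is a reduction
  or a propositional inference of polynomial size as well.
*)
theory Submission
  imports Defs
begin

section \<open>Derivations of bounded size in a Frege system\<close>

text \<open>Reading a merged literal as \<open>u \<or> \<not> u\<close> would make its clause valid
  and useless. The negated equivalence says instead that \<open>u\<close> avoids one particular
  value, and this can be refuted by setting \<open>u\<close> to both constants. Which value it is
  depends on how the line was derived, so different lines may carry different extension variables
  for the same \<open>u\<close>. Resolution can keep such lines apart because the side conditions
  forbid a variable merged in both premises unless it is merged again, and then it receives a new
  extension variable. Every insertion changes the absolute levels of variables, so the invariant
  speaks only of the relative order of variables already present. Formulas of clauses with
  \<open>n\<close> literals have size linear in \<open>n\<close>, and a step makes quadratically
  many schema instances, each of cost linear in that size. One step thus costs a cubic polynomial in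
  \<open>n\<close>, and the refutation a polynomial of degree at most four.\<close>

inductive frege_seq :: "frege_rule set \<Rightarrow> var set \<Rightarrow> fm set \<Rightarrow> fm list \<Rightarrow> bool"
  for R :: "frege_rule set" and X :: "var set" and G :: "fm set" where
  start: "frege_seq R X G []"
| step: "frege_seq R X G L \<Longrightarrow> (Ps, A) \<in> R \<Longrightarrow> \<forall>B\<in>set Ps. subst \<sigma> B \<in> G \<union> set L
    \<Longrightarrow> vars (subst \<sigma> A) \<subseteq> X \<Longrightarrow> frege_seq R X G (L @ [subst \<sigma> A])"

text \<open>Only added lines are charged, hypotheses in \<open>G\<close> are free; this makes costs
  additive under cut. The set \<open>X\<close> stands for the variables of the current prefix, which
  instances of Frege rules may not leave.\<close>

definition prov :: "frege_rule set \<Rightarrow> var set \<Rightarrow> fm set \<Rightarrow> nat \<Rightarrow> fm \<Rightarrow> bool" where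
  "prov R X G N A \<longleftrightarrow> (\<exists>L. frege_seq R X G L \<and> A \<in> G \<union> set L \<and> efrege_size L \<le> N)"

lemma efrege_size_simps [simp]:
  "efrege_size [] = 0" "efrege_size (F # L) = fsize F + efrege_size L"
  "efrege_size (L @ L') = efrege_size L + efrege_size L'"
  by (auto simp: efrege_size_def)

lemma frege_seq_append:
  assumes "frege_seq R X G L" "frege_seq R X H L'" "H \<subseteq> G \<union> set L"
  shows "frege_seq R X G (L @ L')"
  using assms(2)
proof (induction rule: frege_seq.induct)
  case start
  then show ?case using assms by simp
next
  case (step L' Ps A \<sigma>)
  have "frege_seq R X G ((L @ L') @ [subst \<sigma> A])"
    using step assms(3) by (intro frege_seq.step[where Ps = Ps]) auto
  then show ?case by simp
qed

lemma prov_hyp: "A \<in> G \<Longrightarrow> prov R X G N A"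
  unfolding prov_def by (intro exI[of _ "[]"]) (auto intro: frege_seq.start)

lemma prov_mono:
  assumes "prov R X G N A" "G \<subseteq> G'" "N \<le> N'"
  shows "prov R X G' N' A"
proof -
  obtain L where L: "frege_seq R X G L" "A \<in> G \<union> set L" "efrege_size L \<le> N"
    using assms(1) by (auto simp: prov_def)
  have "frege_seq R X G' ([] @ L)"
    by (rule frege_seq_append[OF frege_seq.start L(1)]) (use assms in auto)
  then show ?thesis using L assms by (auto simp: prov_def intro!: exI[of _ L])
qed

lemma prov_cut:
  assumes "prov R X G N A" "prov R X (insert A G) M B"
  shows "prov R X G (N + M) B"
proof -
  obtain L where L: "frege_seq R X G L" "A \<in> G \<union> set L" "efrege_size L \<le> N"
    using assms(1) by (auto simp: prov_def)
  obtain L' where L': "frege_seq R X (insert A G) L'" "B \<in> insert A G \<union> set L'" "efrege_size L' \<le> M"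
    using assms(2) by (auto simp: prov_def)
  have "frege_seq R X G (L @ L')"
    by (rule frege_seq_append[OF L(1) L'(1)]) (use L in auto)
  then show ?thesis using L L' by (auto simp: prov_def intro!: exI[of _ "L @ L'"])
qed

lemma prov_cut_list:
  assumes "\<forall>A\<in>set As. prov R X G N A" "prov R X (set As \<union> G) M B"
  shows "prov R X G (length As * N + M) B"
  using assms
proof (induction As arbitrary: M)
  case Nil
  then show ?case by simp
next
  case (Cons A As)
  have "prov R X (set As \<union> G) N A"
    by (rule prov_mono[of _ _ G]) (use Cons.prems in auto)
  moreover have "prov R X (insert A (set As \<union> G)) M B"
    using Cons.prems by simp
  ultimately have "prov R X (set As \<union> G) (N + M) B" by (rule prov_cut)
  then have "prov R X G (length As * N + (N + M)) B" using Cons by auto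
  then show ?case by (simp add: add.assoc add.left_commute)
qed

section \<open>Substitution instances of Frege derivations and their cost\<close>

lemma subst_subst: "subst \<tau> (subst \<sigma> A) = subst (\<lambda>v. subst \<tau> (\<sigma> v)) A"
  by (induction A) auto

lemma vars_subst: "vars (subst \<sigma> A) = (\<Union>v\<in>vars A. vars (\<sigma> v))"
  by (induction A) auto

lemma fsize_pos: "1 \<le> fsize A"
  by (induction A) auto

lemma fsize_subst_le:
  assumes "\<forall>v. fsize (\<sigma> v) \<le> m" "1 \<le> m"
  shows "fsize (subst \<sigma> A) \<le> fsize A * m"
  using assms by (induction A) (auto simp: algebra_simps)

text \<open>A derivation remains one under any substitution \<open>\<tau>\<close>, and its lines
  grow by a factor of at most \<open>m\<close>; hence \<open>c\<close> can be fixed before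
  \<open>X\<close>, \<open>G\<close>, \<open>\<tau>\<close> and \<open>m\<close>. The condition on
  \<open>\<tau>\<close> ranges over all variables because intermediate formulas may contain
  variables that occur neither in \<open>\<Gamma>\<close> nor in \<open>A\<close>.\<close>

lemma frege_derivable_prov:
  assumes "frege_derivable R \<Gamma> A"
  shows "\<exists>c. \<forall>X G \<tau> m. (\<forall>v. vars (\<tau> v) \<subseteq> X \<and> fsize (\<tau> v) \<le> m) \<longrightarrow> 1 \<le> m \<longrightarrow>
           subst \<tau> ` \<Gamma> \<subseteq> G \<longrightarrow> prov R X G (c * m) (subst \<tau> A)"
  using assms
proof (induction rule: frege_derivable.induct)
  case (hyp A)
  then show ?case by (auto intro!: prov_hyp)
next
  case (rule Ps A \<sigma>)
  let ?P = "\<lambda>B c. \<forall>X G \<tau> m. (\<forall>v. vars (\<tau> v) \<subseteq> X \<and> fsize (\<tau> v) \<le> m) \<longrightarrow> 1 \<le> m \<longrightarrow>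
     subst \<tau> ` \<Gamma> \<subseteq> G \<longrightarrow> prov R X G (c * m) (subst \<tau> (subst \<sigma> B))"
  obtain c where c: "?P B (c B)" if "B \<in> set Ps" for B
    using rule.IH by metis
  define d where "d = (\<Sum>B\<leftarrow>Ps. c B)"
  have d: "c B \<le> d" if "B \<in> set Ps" for B
    unfolding d_def using that by (simp add: member_le_sum_list)
  show ?case
  proof (intro exI[of _ "length Ps * d + fsize (subst \<sigma> A)"] allI impI)
    fix X G and \<tau> :: "nat \<Rightarrow> fm" and m
    assume \<tau>: "\<forall>v. vars (\<tau> v) \<subseteq> X \<and> fsize (\<tau> v) \<le> m" and m: "1 \<le> m"
      and G: "subst \<tau> ` \<Gamma> \<subseteq> G"
    let ?As = "map (\<lambda>B. subst \<tau> (subst \<sigma> B)) Ps"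
    have prems: "\<forall>A\<in>set ?As. prov R X G (d * m) A"
    proof
      fix A assume "A \<in> set ?As"
      then obtain B where B: "B \<in> set Ps" "A = subst \<tau> (subst \<sigma> B)" by auto
      have "prov R X G (c B * m) A" using c[OF B(1)] \<tau> m G B(2) by blast
      then show "prov R X G (d * m) A"
        by (rule prov_mono) (use d[OF B(1)] in auto)
    qed
    have "frege_seq R X (set ?As \<union> G) ([] @ [subst (\<lambda>v. subst \<tau> (\<sigma> v)) A])"
      using rule.hyps(1)
      by (intro frege_seq.step[where Ps = Ps] frege_seq.start)
         (use \<tau> in \<open>auto simp: subst_subst vars_subst\<close>)
    moreover have "fsize (subst (\<lambda>v. subst \<tau> (\<sigma> v)) A) \<le> fsize (subst \<sigma> A) * m"
      using fsize_subst_le[of \<tau> m "subst \<sigma> A"] \<tau> m by (simp add: subst_subst)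
    ultimately have "prov R X (set ?As \<union> G) (fsize (subst \<sigma> A) * m) (subst \<tau> (subst \<sigma> A))"
      unfolding prov_def by (intro exI[of _ "[subst (\<lambda>v. subst \<tau> (\<sigma> v)) A]"])
        (auto simp: subst_subst)
    from prov_cut_list[OF prems this]
    show "prov R X G ((length Ps * d + fsize (subst \<sigma> A)) * m) (subst \<tau> (subst \<sigma> A))"
      by (simp add: algebra_simps)
  qed
qed

definition small :: "nat \<Rightarrow> fm set" where
  "small k = {A. vars A \<subseteq> {..<k} \<and> fsize A \<le> k}"

lemma finite_bounded_fms: "finite V \<Longrightarrow> finite {A :: fm. vars A \<subseteq> V \<and> fsize A \<le> n}"
proof (induction n)
  case 0
  have "{A :: fm. vars A \<subseteq> V \<and> fsize A \<le> 0} = {}"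
    using fsize_pos not_one_le_zero by (metis (mono_tags, lifting) Collect_empty_eq le_zero_eq)
  then show ?case by (simp only: finite.emptyI)
next
  case (Suc n)
  let ?S = "{A :: fm. vars A \<subseteq> V \<and> fsize A \<le> n}"
  let ?T = "{Bot, Top} \<union> Var ` V \<union> Not ` ?S \<union>
    (\<lambda>(A, B). And A B) ` (?S \<times> ?S) \<union> (\<lambda>(A, B). Or A B) ` (?S \<times> ?S) \<union>
    (\<lambda>(A, B). Imp A B) ` (?S \<times> ?S) \<union> (\<lambda>(A, B). Iff A B) ` (?S \<times> ?S)"
  have "{A. vars A \<subseteq> V \<and> fsize A \<le> Suc n} \<subseteq> ?T"
  proof
    fix A :: fm assume "A \<in> {A. vars A \<subseteq> V \<and> fsize A \<le> Suc n}"
    then show "A \<in> ?T" by (cases A) (auto simp: image_iff)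
  qed
  moreover have "finite ?T" using Suc by auto
  ultimately show ?case by (rule finite_subset)
qed

text \<open>The default \<open>Bot\<close> keeps every value within the allowed variables and size,
  also at variables that only a hidden Frege derivation brings in.\<close>

definition inst :: "fm list \<Rightarrow> var \<Rightarrow> fm" where
  "inst As v = (if v < length As then As ! v else Bot)"

text \<open>A Frege system comes without any bound on the size of its proofs, but only finitely many
  entailments are used as derived rules, so that instances of all of them cost at most a constant
  times the size of the substituted formulas.\<close>

lemma small_entailments_linear_cost:
  assumes "frege_system R"
  shows "\<exists>c. \<forall>\<Gamma> A X G \<tau> m. \<Gamma> \<subseteq> small k \<longrightarrow> A \<in> small k \<longrightarrow> entails \<Gamma> A \<longrightarrow>
     (\<forall>v. vars (\<tau> v) \<subseteq> X \<and> fsize (\<tau> v) \<le> m) \<longrightarrow> 1 \<le> m \<longrightarrow>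
     subst \<tau> ` \<Gamma> \<subseteq> G \<longrightarrow> prov R X G (c * m) (subst \<tau> A)"
proof -
  have fin: "finite (small k)" unfolding small_def by (rule finite_bounded_fms) simp
  let ?P = "\<lambda>\<Gamma> A c. \<forall>X G \<tau> m. (\<forall>v. vars (\<tau> v) \<subseteq> X \<and> fsize (\<tau> v) \<le> m) \<longrightarrow> 1 \<le> m \<longrightarrow>
     subst \<tau> ` \<Gamma> \<subseteq> G \<longrightarrow> prov R X G (c * m) (subst \<tau> A)"
  have "\<exists>c. ?P \<Gamma> A c" if "\<Gamma> \<subseteq> small k" "entails \<Gamma> A" for \<Gamma> A
  proof -
    have "frege_derivable R \<Gamma> A"
      using assms that finite_subset[OF that(1) fin] by (auto simp: frege_system_def)
    then show ?thesis by (rule frege_derivable_prov)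
  qed
  then obtain c where c: "?P \<Gamma> A (c \<Gamma> A)" if "\<Gamma> \<subseteq> small k" "entails \<Gamma> A" for \<Gamma> A
    by metis
  \<comment> \<open>A sum over the finitely many pairs is a common upper bound for all the
    individual constants.\<close>
  define d where "d = (\<Sum>(\<Gamma>, A)\<in>Pow (small k) \<times> small k. c \<Gamma> A)"
  have d: "c \<Gamma> A \<le> d" if "\<Gamma> \<subseteq> small k" "A \<in> small k" for \<Gamma> A
    unfolding d_def
    using member_le_sum[of "(\<Gamma>, A)" "Pow (small k) \<times> small k" "\<lambda>(\<Gamma>, A). c \<Gamma> A"] that fin
    by simp
  show ?thesis
  proof (intro exI[of _ d] allI impI)
    fix \<Gamma> A X G and \<tau> :: "nat \<Rightarrow> fm" and m
    assume *: "\<Gamma> \<subseteq> small k" "A \<in> small k" "entails \<Gamma> A"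
      and **: "\<forall>v. vars (\<tau> v) \<subseteq> X \<and> fsize (\<tau> v) \<le> m" "1 \<le> m" "subst \<tau> ` \<Gamma> \<subseteq> G"
    have "prov R X G (c \<Gamma> A * m) (subst \<tau> A)"
      using c[OF *(1,3)] ** by simp
    then show "prov R X G (d * m) (subst \<tau> A)"
      by (rule prov_mono) (use d[OF *(1,2)] in simp_all)
  qed
qed

section \<open>Reasoning with disjunctions of unbounded length\<close>

definition bigor :: "fm list \<Rightarrow> fm" where
  "bigor ds = foldr Or ds Bot"

lemma bigor_simps [simp]: "bigor [] = Bot" "bigor (d # ds) = Or d (bigor ds)"
  by (auto simp: bigor_def)

lemma vars_bigor: "vars (bigor ds) = (\<Union>d\<in>set ds. vars d)"
  by (induction ds) auto

lemma subst_bigor: "subst \<sigma> (bigor ds) = bigor (map (subst \<sigma>) ds)"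
  by (induction ds) auto

lemma fsize_bigor_le: "\<forall>d\<in>set ds. fsize d \<le> k \<Longrightarrow> fsize (bigor ds) \<le> length ds * (k + 1) + 1"
  by (induction ds) auto

lemma fsize_mem_bigor: "d \<in> set ds \<Longrightarrow> fsize d \<le> fsize (bigor ds)"
  by (induction ds) auto

text \<open>The number 25 is generous: the schemata used below have at most 10 symbols and the
  variables 0 to 6.\<close>

locale frege_cost =
  fixes R :: "frege_rule set" and c :: nat
  assumes cost: "\<And>\<Gamma> A X G \<tau> m. \<lbrakk>\<Gamma> \<subseteq> small 25; A \<in> small 25; entails \<Gamma> A;
    \<forall>v. vars (\<tau> v) \<subseteq> X \<and> fsize (\<tau> v) \<le> m; 1 \<le> m; subst \<tau> ` \<Gamma> \<subseteq> G\<rbrakk>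
    \<Longrightarrow> prov R X G (c * m) (subst \<tau> A)"
begin

lemma prov_rule:
  assumes "entails (set Ps) A" "set Ps \<subseteq> small 25" "A \<in> small 25"
    and As: "\<forall>F\<in>set As. vars F \<subseteq> X \<and> fsize F \<le> m" and m: "1 \<le> m"
    and prems: "\<forall>B\<in>set (map (subst (inst As)) Ps). prov R X G N B"
  shows "prov R X G (length Ps * N + c * m) (subst (inst As) A)"
proof -
  have "prov R X (set (map (subst (inst As)) Ps) \<union> G) (c * m) (subst (inst As) A)"
    by (rule cost[OF assms(2,3,1) _ m]) (use As m in \<open>auto simp: inst_def\<close>)
  from prov_cut_list[OF prems this] show ?thesis by simp
qed

lemmas schema_simps = entails_def small_def inst_def

lemma prov_or_left:
  assumes "vars (Or A B) \<subseteq> X" "fsize (Or A B) \<le> m"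
  shows "prov R X G (c * m) (Imp A (Or A B))"
  using prov_rule[of "[]" "Imp (Var 0) (Or (Var 0) (Var 1))" "[A, B]" X m G 0] assms fsize_pos[of A]
  by (auto simp: schema_simps)

lemma prov_or_right:
  assumes "vars (Imp A (Or B D)) \<subseteq> X" "fsize (Or B D) \<le> m" "fsize A \<le> m"
    and "prov R X G N (Imp A D)"
  shows "prov R X G (N + c * m) (Imp A (Or B D))"
  using prov_rule[of "[Imp (Var 0) (Var 2)]" "Imp (Var 0) (Or (Var 1) (Var 2))" "[A, B, D]" X m G N]
    assms fsize_pos[of A]
  by (auto simp: schema_simps)

lemma prov_bot:
  assumes "vars E \<subseteq> X" "fsize E \<le> m"
  shows "prov R X G (c * m) (Imp Bot E)"
  using prov_rule[of "[]" "Imp Bot (Var 0)" "[E]" X m G 0] assms fsize_pos[of E]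
  by (auto simp: schema_simps)

lemma prov_not_top:
  assumes "vars E \<subseteq> X" "fsize E \<le> m"
  shows "prov R X G (c * m) (Imp (Not Top) E)"
  using prov_rule[of "[]" "Imp (Not Top) (Var 0)" "[E]" X m G 0] assms fsize_pos[of E]
  by (auto simp: schema_simps)

lemma prov_or_elim:
  assumes "vars (Or A B) \<subseteq> X" "vars E \<subseteq> X" "fsize (Or A B) \<le> m" "fsize E \<le> m"
    and "prov R X G N (Imp A E)" "prov R X G M (Imp B E)"
  shows "prov R X G (N + M + c * m) (Imp (Or A B) E)"
proof -
  \<comment> \<open>\<open>prov_rule\<close> charges all premises the same. Here they have different
    costs, so they enter as free hypotheses and are cut in afterwards.\<close>
  let ?H = "insert (Imp B E) (insert (Imp A E) G)"
  have "prov R X ?H (2 * 0 + c * m) (Imp (Or A B) E)"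
    using prov_rule[of "[Imp (Var 0) (Var 2), Imp (Var 1) (Var 2)]"
        "Imp (Or (Var 0) (Var 1)) (Var 2)" "[A, B, E]" X m ?H 0] assms fsize_pos[of E]
    by (auto simp: schema_simps prov_hyp)
  moreover have "prov R X (insert (Imp A E) G) M (Imp B E)"
    by (rule prov_mono[OF assms(6)]) auto
  ultimately have "prov R X (insert (Imp A E) G) (M + c * m) (Imp (Or A B) E)"
    using prov_cut by fastforce
  from prov_cut[OF assms(5) this] show ?thesis by (simp add: add.assoc)
qed

lemma prov_mp:
  assumes "vars A \<subseteq> X" "vars B \<subseteq> X" "fsize A \<le> m" "fsize B \<le> m"
    and "A \<in> G" "prov R X G N (Imp A B)"
  shows "prov R X G (N + c * m) B"
proof -
  let ?H = "insert (Imp A B) G"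
  have "prov R X ?H (2 * 0 + c * m) B"
    using prov_rule[of "[Var 0, Imp (Var 0) (Var 1)]" "Var 1" "[A, B]" X m ?H 0] assms fsize_pos[of A]
    by (auto simp: schema_simps prov_hyp)
  then show ?thesis using prov_cut[OF assms(6)] by simp
qed

lemma prov_bigor_intro:
  assumes "d \<in> set ds" "vars (bigor ds) \<subseteq> X" "fsize (bigor ds) \<le> m"
  shows "prov R X G (length ds * (c * m)) (Imp d (bigor ds))"
  using assms
proof (induction ds)
  case (Cons e es)
  show ?case
  proof (cases "d = e")
    case True
    have "prov R X G (c * m) (Imp e (Or e (bigor es)))"
      by (rule prov_or_left) (use Cons.prems in auto)
    then show ?thesis using True by (auto intro: prov_mono)
  next
    case False
    then have d: "d \<in> set es" using Cons.prems by auto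
    have "prov R X G (length es * (c * m)) (Imp d (bigor es))"
      using Cons d by auto
    then have "prov R X G (length es * (c * m) + c * m) (Imp d (Or e (bigor es)))"
      using Cons.prems d fsize_mem_bigor[OF d]
      by (intro prov_or_right) (auto simp: vars_bigor)
    then show ?thesis by (simp add: add.commute)
  qed
qed simp

lemma prov_bigor_elim:
  assumes "\<forall>d\<in>set ds. prov R X G N (Imp d E)" "vars (bigor ds) \<subseteq> X" "vars E \<subseteq> X"
    and "fsize (bigor ds) \<le> m" "fsize E \<le> m"
  shows "prov R X G (length ds * (N + c * m) + c * m) (Imp (bigor ds) E)"
  using assms
proof (induction ds)
  case Nil
  then show ?case by (auto intro: prov_bot)
next
  case (Cons d ds)
  have "prov R X G (length ds * (N + c * m) + c * m) (Imp (bigor ds) E)"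
    using Cons by auto
  then have "prov R X G (N + (length ds * (N + c * m) + c * m) + c * m) (Imp (Or d (bigor ds)) E)"
    using Cons.prems by (intro prov_or_elim) auto
  then show ?case by (simp add: algebra_simps)
qed

lemma prov_bigor_cases:
  assumes "bigor ds \<in> G" "\<forall>d\<in>set ds. prov R X G N (Imp d E)" "vars (bigor ds) \<subseteq> X" "vars E \<subseteq> X"
    and "fsize (bigor ds) \<le> m" "fsize E \<le> m" "length ds \<le> n"
  shows "prov R X G (n * (N + c * m) + 2 * c * m) E"
proof -
  have "prov R X G (length ds * (N + c * m) + c * m + c * m) E"
    by (rule prov_mp[OF assms(3,4,5,6,1)]) (rule prov_bigor_elim[OF assms(2-6)])
  then show ?thesis by (rule prov_mono) (use assms(7) in auto)
qed

lemma prov_weaken: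
  assumes "prov R X G N (Imp A E)" "vars (Imp A (Imp B E)) \<subseteq> X"
    and "fsize A \<le> m" "fsize B \<le> m" "fsize E \<le> m"
  shows "prov R X G (N + c * m) (Imp A (Imp B E))"
  using prov_rule[of "[Imp (Var 0) (Var 2)]" "Imp (Var 0) (Imp (Var 1) (Var 2))" "[A, B, E]" X m G N]
    assms fsize_pos[of A]
  by (auto simp: schema_simps)

lemma prov_case_split:
  assumes "prov R X G N (Imp p E)" "prov R X G N (Imp (Not p) E)"
    and "vars p \<subseteq> X" "vars E \<subseteq> X" "fsize p \<le> m" "fsize E \<le> m"
  shows "prov R X G (2 * N + c * m) E"
  using prov_rule[of "[Imp (Var 0) (Var 1), Imp (Not (Var 0)) (Var 1)]" "Var 1" "[p, E]" X m G N]
    assms fsize_pos[of p]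
  by (auto simp: schema_simps mult_2)

text \<open>The common pattern of resolution and of the reduction of a merged literal:
  \<open>p\<close> is the pivot in the former and the extension variable in the latter. Each
  disjunct has to yield \<open>E\<close> only in the branch of its own disjunction.\<close>

lemma prov_two_bigors:
  assumes "bigor ds1 \<in> G" "bigor ds2 \<in> G"
    and "\<forall>d\<in>set ds1. prov R X G N (Imp d (Imp p E))"
    and "\<forall>d\<in>set ds2. prov R X G N (Imp d (Imp (Not p) E))"
    and "vars (bigor ds1) \<subseteq> X" "vars (bigor ds2) \<subseteq> X" "vars p \<subseteq> X" "vars E \<subseteq> X"
    and "fsize (bigor ds1) \<le> m" "fsize (bigor ds2) \<le> m" "fsize (Imp (Not p) E) \<le> m"
    and "length ds1 \<le> n" "length ds2 \<le> n"
  shows "prov R X G (2 * (n * (N + c * m) + 2 * c * m) + c * m) E"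
proof (rule prov_case_split[of _ _ _ p])
  show "prov R X G (n * (N + c * m) + 2 * c * m) (Imp p E)"
    by (rule prov_bigor_cases[OF assms(1,3)]) (use assms in auto)
  show "prov R X G (n * (N + c * m) + 2 * c * m) (Imp (Not p) E)"
    by (rule prov_bigor_cases[OF assms(2,4)]) (use assms in auto)
qed (use assms in auto)

end

section \<open>Bounded Frege proofs inside extended Frege with reduction\<close>

lemma efrege_red_prov:
  assumes "efrege_red R \<Pi> \<phi> \<Pi>' L" "prov R (pvars \<Pi>') (set L) N A"
  shows "\<exists>L'. efrege_red R \<Pi> \<phi> \<Pi>' (L @ L') \<and> A \<in> set (L @ L') \<and> efrege_size L' \<le> N"
proof -
  obtain L' where L': "frege_seq R (pvars \<Pi>') (set L) L'" "A \<in> set L \<union> set L'" "efrege_size L' \<le> N"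
    using assms(2) by (auto simp: prov_def)
  from L'(1) have "efrege_red R \<Pi> \<phi> \<Pi>' (L @ L')"
  proof (induction rule: frege_seq.induct)
    case start
    then show ?case using assms(1) by simp
  next
    case (step L' Ps A \<sigma>)
    have "efrege_red R \<Pi> \<phi> \<Pi>' ((L @ L') @ [subst \<sigma> A])"
      using step by (intro efrege_red.frege[where Ps = Ps]) auto
    then show ?case by simp
  qed
  then show ?thesis using L' by auto
qed

section \<open>Inserting extension variables into the prefix\<close>

lemma pvars_simps [simp]:
  "pvars [] = {}" "pvars (p # \<Pi>) = insert (snd p) (pvars \<Pi>)"
  "pvars (\<Pi>1 @ \<Pi>2) = pvars \<Pi>1 \<union> pvars \<Pi>2"
  by (auto simp: pvars_def)

lemma finite_pvars [simp]: "finite (pvars \<Pi>)"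
  by (simp add: pvars_def)

lemma lev_append: "lev (\<Pi>1 @ \<Pi>2) v = (if v \<in> pvars \<Pi>1 then lev \<Pi>1 v else length \<Pi>1 + lev \<Pi>2 v)"
  by (induction \<Pi>1) auto

lemma lev_le_length: "lev \<Pi> v \<le> length \<Pi>"
  by (induction \<Pi>) auto

lemma lev_less_length_iff: "lev \<Pi> v < length \<Pi> \<longleftrightarrow> v \<in> pvars \<Pi>"
  by (induction \<Pi>) auto

text \<open>A variable outside the prefix gets the level \<open>length \<Pi>\<close>, the largest
  possible one, so whatever is left of something belongs to the prefix.\<close>

lemma lev_less_pvars: "lev \<Pi> v < lev \<Pi> w \<Longrightarrow> v \<in> pvars \<Pi>"
  using lev_le_length[of \<Pi> w] lev_less_length_iff[of \<Pi> v] by linarith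

text \<open>An insertion shifts all levels to its right, so only comparisons between old variables
  survive. Inclusion of the quantified pairs, not just of the variables, keeps universal variables
  universal.\<close>

definition extends :: "prefix \<Rightarrow> prefix \<Rightarrow> bool" where
  "extends \<Pi> \<Pi>' \<longleftrightarrow> distinct (map snd \<Pi>') \<and> set \<Pi> \<subseteq> set \<Pi>' \<and>
     (\<forall>a\<in>pvars \<Pi>. \<forall>b\<in>pvars \<Pi>. lev \<Pi>' a < lev \<Pi>' b \<longleftrightarrow> lev \<Pi> a < lev \<Pi> b)"

lemma extends_refl: "distinct (map snd \<Pi>) \<Longrightarrow> extends \<Pi> \<Pi>"
  by (simp add: extends_def)

lemma extends_pvars: "extends \<Pi> \<Pi>' \<Longrightarrow> pvars \<Pi> \<subseteq> pvars \<Pi>'"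
  by (auto simp: extends_def pvars_def)

lemma extends_trans: "extends \<Pi> \<Pi>' \<Longrightarrow> extends \<Pi>' \<Pi>'' \<Longrightarrow> extends \<Pi> \<Pi>''"
  using extends_pvars[of \<Pi> \<Pi>'] by (auto simp: extends_def subset_iff)

lemma extends_insert:
  assumes "distinct (map snd (\<Pi>1 @ \<Pi>2))" "v \<notin> pvars (\<Pi>1 @ \<Pi>2)"
  shows "extends (\<Pi>1 @ \<Pi>2) (\<Pi>1 @ (Exists, v) # \<Pi>2)"
proof -
  have "lev (\<Pi>1 @ (Exists, v) # \<Pi>2) a < lev (\<Pi>1 @ (Exists, v) # \<Pi>2) b \<longleftrightarrow>
      lev (\<Pi>1 @ \<Pi>2) a < lev (\<Pi>1 @ \<Pi>2) b"
    if "a \<in> pvars (\<Pi>1 @ \<Pi>2)" "b \<in> pvars (\<Pi>1 @ \<Pi>2)" for a b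
  proof -
    have "a \<noteq> v" "b \<noteq> v" using that assms by auto
    then show ?thesis using lev_less_length_iff[of \<Pi>1 a] lev_less_length_iff[of \<Pi>1 b]
      by (auto simp: lev_append)
  qed
  then show ?thesis using assms by (auto simp: extends_def pvars_def)
qed

lemma add_extension_left_of:
  assumes "efrege_red R \<Pi> \<phi> \<Pi>' L" "distinct (map snd \<Pi>')" "u \<in> pvars \<Pi>'"
    and left: "\<forall>a\<in>vars A. lev \<Pi>' a < lev \<Pi>' u"
  shows "\<exists>\<Pi>'' e. efrege_red R \<Pi> \<phi> \<Pi>'' (L @ [Iff (Var e) A]) \<and> extends \<Pi>' \<Pi>'' \<and>
           lev \<Pi>'' e < lev \<Pi>'' u"
proof -
  obtain q where "(q, u) \<in> set \<Pi>'" using assms(3) by (auto simp: pvars_def)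
  then obtain \<Pi>1 \<Pi>2 where split: "\<Pi>' = \<Pi>1 @ (q, u) # \<Pi>2"
    by (meson split_list)
  have u: "u \<notin> pvars \<Pi>1" using assms(2) split by (auto simp: pvars_def)
  obtain e where e: "e \<notin> pvars \<Pi>'"
    using ex_new_if_finite[OF infinite_UNIV_nat finite_pvars] by blast
  \<comment> \<open>With \<open>e\<close> directly in front of \<open>u\<close>, everything left of
    \<open>u\<close> lies in \<open>\<Pi>1\<close>, which is where the extension rule wants the
    variables of \<open>A\<close>.\<close>
  let ?\<Pi> = "\<Pi>1 @ (Exists, e) # (q, u) # \<Pi>2"
  have "vars A \<subseteq> pvars \<Pi>1"
    using left u by (auto simp: split lev_append split: if_splits)
  then have "efrege_red R \<Pi> \<phi> ?\<Pi> (L @ [Iff (Var e) A])"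
    using assms(1) e by (intro efrege_red.extension) (auto simp: split)
  moreover have "extends \<Pi>' ?\<Pi>"
    using extends_insert[of \<Pi>1 "(q, u) # \<Pi>2" e] assms(2) e by (simp add: split)
  moreover have "lev ?\<Pi> e < lev ?\<Pi> u"
    using e u by (auto simp: split lev_append)
  ultimately show ?thesis by blast
qed

text \<open>Each \<open>A u\<close> mentions old variables only, being left of \<open>u\<close> in
  \<open>\<Pi>'\<close>, so inserting the other extension variables preserves the conditions on it.
  The summand 2 counts the new variable and the equivalence sign.\<close>

lemma add_extensions_left_of:
  assumes "finite S" "efrege_red R \<Pi> \<phi> \<Pi>' L" "distinct (map snd \<Pi>')" "S \<subseteq> pvars \<Pi>'"
    and "\<forall>u\<in>S. \<forall>a\<in>vars (A u). lev \<Pi>' a < lev \<Pi>' u" "\<forall>u\<in>S. fsize (A u) \<le> k"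
  shows "\<exists>\<Pi>'' L' e. efrege_red R \<Pi> \<phi> \<Pi>'' (L @ L') \<and> extends \<Pi>' \<Pi>'' \<and>
           (\<forall>u\<in>S. lev \<Pi>'' (e u) < lev \<Pi>'' u \<and> Iff (Var (e u)) (A u) \<in> set L') \<and>
           efrege_size L' \<le> card S * (k + 2)"
  using assms(1,4-6)
proof (induction rule: finite_induct)
  case empty
  then show ?case using assms(2,3) extends_refl
    by (intro exI[of _ \<Pi>'] exI[of _ "[]"]) auto
next
  case (insert u S)
  then obtain \<Pi>1 L1 e where IH: "efrege_red R \<Pi> \<phi> \<Pi>1 (L @ L1)" "extends \<Pi>' \<Pi>1"
      "\<forall>u\<in>S. lev \<Pi>1 (e u) < lev \<Pi>1 u \<and> Iff (Var (e u)) (A u) \<in> set L1"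
      "efrege_size L1 \<le> card S * (k + 2)"
    by auto
  have sub: "pvars \<Pi>' \<subseteq> pvars \<Pi>1" by (rule extends_pvars[OF IH(2)])
  have dist: "distinct (map snd \<Pi>1)" using IH(2) by (simp add: extends_def)
  have u: "u \<in> pvars \<Pi>1" using sub insert.prems by auto
  have low: "\<forall>a\<in>vars (A u). lev \<Pi>1 a < lev \<Pi>1 u"
  proof
    fix a assume "a \<in> vars (A u)"
    then have "lev \<Pi>' a < lev \<Pi>' u" using insert.prems by auto
    then show "lev \<Pi>1 a < lev \<Pi>1 u"
      using IH(2) lev_less_pvars[of \<Pi>' a u] insert.prems by (auto simp: extends_def)
  qed
  then obtain \<Pi>2 f where ext: "efrege_red R \<Pi> \<phi> \<Pi>2 ((L @ L1) @ [Iff (Var f) (A u)])"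
      "extends \<Pi>1 \<Pi>2" "lev \<Pi>2 f < lev \<Pi>2 u"
    using add_extension_left_of[OF IH(1) dist u low] by auto
  have "lev \<Pi>2 (e w) < lev \<Pi>2 w" if "w \<in> S" for w
    using ext(2) IH(3) that sub insert.prems lev_less_pvars[of \<Pi>1 "e w" w]
    by (auto simp: extends_def)
  moreover have "efrege_size (L1 @ [Iff (Var f) (A u)]) \<le> card (insert u S) * (k + 2)"
    using IH(4) insert by simp
  ultimately show ?case
    using ext extends_trans[OF IH(2) ext(2)] IH(3) insert.hyps
    by (intro exI[of _ \<Pi>2] exI[of _ "L1 @ [Iff (Var f) (A u)]"] exI[of _ "e(u := f)"]) auto
qed

section \<open>Formulas for clauses with merged literals\<close>

text \<open>A merged literal \<open>u*\<close> becomes \<open>\<not> (u \<leftrightarrow> V u)\<close>, where \<open>V u\<close> is an extension variable left of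
  \<open>u\<close>. If \<open>C1\<close> and \<open>U1\<close> overlap in an instance of long-distance resolution, then a clause may
  contain an ordinary literal besides \<open>u*\<close>. The ordinary one has to be dropped, for
  \<open>u \<or> \<not> (u \<leftrightarrow> V u)\<close> is valid if \<open>V u\<close> is true.\<close>

definition litf :: "(var \<Rightarrow> var) \<Rightarrow> qclause \<Rightarrow> var \<Rightarrow> fm" where
  "litf V K v = (if Merged v \<in> K then Not (Iff (Var v) (Var (V v)))
     else if Ord (Pos v) \<in> K then Var v else Not (Var v))"

definition disjuncts :: "(var \<Rightarrow> var) \<Rightarrow> qclause \<Rightarrow> fm list" where
  "disjuncts V K = map (litf V K) (sorted_list_of_set (qvar ` K))"

text \<open>The value of \<open>v\<close> that makes \<open>litf V K v\<close> false. Ordinary and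
  merged literals are thereby treated alike: each is equivalent to
  \<open>Not (Iff (Var v) (falsifier V K v))\<close>.\<close>

definition falsifier :: "(var \<Rightarrow> var) \<Rightarrow> qclause \<Rightarrow> var \<Rightarrow> fm" where
  "falsifier V K v = (if Merged v \<in> K then Var (V v) else if Ord (Pos v) \<in> K then Bot else Top)"

definition left_of :: "prefix \<Rightarrow> (var \<Rightarrow> var) \<Rightarrow> qclause \<Rightarrow> bool" where
  "left_of \<Pi> V K \<longleftrightarrow> (\<forall>v. Merged v \<in> K \<longrightarrow> lev \<Pi> (V v) < lev \<Pi> v)"

text \<open>Complementary ordinary literals have to be excluded, since \<open>litf\<close> keeps at
  most one literal per variable and would strengthen such a clause. An ordinary literal beside a
  merged one is tolerated.\<close>

definition proper :: "prefix \<Rightarrow> qclause \<Rightarrow> bool" where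
  "proper \<Pi> K \<longleftrightarrow> finite K \<and> qvar ` K \<subseteq> pvars \<Pi> \<and> (\<forall>v. \<not> (Ord (Pos v) \<in> K \<and> Ord (Neg v) \<in> K))"

lemma set_disjuncts: "finite K \<Longrightarrow> set (disjuncts V K) = litf V K ` qvar ` K"
  by (simp add: disjuncts_def)

lemma length_disjuncts: "finite K \<Longrightarrow> length (disjuncts V K) \<le> card K"
  by (simp add: disjuncts_def card_image_le)

lemma fsize_litf: "fsize (litf V K v) \<le> 4"
  by (simp add: litf_def)

lemma vars_litf: "vars (litf V K v) = insert v (if Merged v \<in> K then {V v} else {})"
  by (auto simp: litf_def)

lemma fsize_disjuncts:
  assumes "finite K" "card K \<le> n"
  shows "fsize (bigor (disjuncts V K)) \<le> 5 * n + 1"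
proof -
  have "fsize (bigor (disjuncts V K)) \<le> length (disjuncts V K) * (4 + 1) + 1"
    by (rule fsize_bigor_le) (auto simp: disjuncts_def fsize_litf)
  also have "\<dots> \<le> n * (4 + 1) + 1"
    using length_disjuncts[OF assms(1), of V] assms(2) by (intro add_mono mult_mono) auto
  finally show ?thesis by simp
qed

lemma vars_disjuncts:
  assumes "finite K" "qvar ` K \<subseteq> pvars \<Pi>'" "left_of \<Pi>' V K"
  shows "vars (bigor (disjuncts V K)) \<subseteq> pvars \<Pi>'"
  using assms lev_less_pvars
  by (fastforce simp: vars_bigor set_disjuncts vars_litf left_of_def split: if_splits)

lemma litf_cong:
  assumes "\<And>l. qvar l = v \<Longrightarrow> l \<in> K \<longleftrightarrow> l \<in> K'" "Merged v \<in> K \<Longrightarrow> V v = V' v"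
  shows "litf V K v = litf V' K' v"
  using assms(1)[of "Merged v"] assms(1)[of "Ord (Pos v)"] assms(2) by (auto simp: litf_def)

lemma qlit_cases: "k = Merged (qvar k) \<or> k = Ord (Pos (qvar k)) \<or> k = Ord (Neg (qvar k))"
proof (cases k)
  case (Ord l)
  then show ?thesis by (cases l) auto
qed auto

text \<open>\<open>V\<close> is chosen per line, because two lines may owe the same merged literal
  to different resolution steps.\<close>

definition line_ok :: "prefix \<Rightarrow> prefix \<Rightarrow> fm list \<Rightarrow> qclause \<Rightarrow> bool" where
  "line_ok \<Pi> \<Pi>' L K \<longleftrightarrow> proper \<Pi> K \<and> (\<exists>V. left_of \<Pi>' V K \<and> bigor (disjuncts V K) \<in> set L)"

lemma left_of_extends:
  assumes "left_of \<Pi>' V K" "qvar ` K \<subseteq> pvars \<Pi>'" "extends \<Pi>' \<Pi>''"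
  shows "left_of \<Pi>'' V K"
  unfolding left_of_def
proof (intro allI impI)
  fix v assume v: "Merged v \<in> K"
  then have "lev \<Pi>' (V v) < lev \<Pi>' v" "v \<in> pvars \<Pi>'"
    using assms(1,2) by (auto simp: left_of_def)
  then show "lev \<Pi>'' (V v) < lev \<Pi>'' v"
    using assms(3) lev_less_pvars[of \<Pi>' "V v" v] by (auto simp: extends_def)
qed

lemma line_ok_extends:
  assumes "line_ok \<Pi> \<Pi>' L K" "extends \<Pi> \<Pi>'" "extends \<Pi>' \<Pi>''"
  shows "line_ok \<Pi> \<Pi>'' (L @ L') K"
proof -
  have "qvar ` K \<subseteq> pvars \<Pi>'"
    using assms(1) extends_pvars[OF assms(2)] by (auto simp: line_ok_def proper_def)
  then show ?thesis using assms(1) left_of_extends[OF _ _ assms(3)]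
    unfolding line_ok_def set_append by blast
qed

section \<open>Simulation of single steps\<close>

lemma fsize_subst_const: "fsize B = 1 \<Longrightarrow> fsize (subst (Var(u := B)) F) = fsize F"
  by (induction F) auto

lemma litf_subst:
  assumes "v \<noteq> u" "Merged v \<in> K \<Longrightarrow> V v \<noteq> u"
  shows "subst (Var(u := B)) (litf V K v) = litf V K v"
  using assms by (simp add: litf_def)

lemma simulate_clause:
  assumes "closed_pcnf \<Pi> \<phi>" "efrege_red R \<Pi> \<phi> \<Pi>' L" "C \<in> \<phi>" "\<not> tautological C"
    and "card (Ord ` C) \<le> n"
  shows "\<exists>F. efrege_red R \<Pi> \<phi> \<Pi>' (L @ [F]) \<and> line_ok \<Pi> \<Pi>' (L @ [F]) (Ord ` C) \<and>
           fsize F \<le> 5 * n + 1"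
proof -
  have C: "finite C" "lvar ` C \<subseteq> pvars \<Pi>"
    using assms(1,3) by (auto simp: closed_pcnf_def)
  have taut: "\<not> (Pos v \<in> C \<and> Neg v \<in> C)" for v
    using assms(4) by (force simp: tautological_def)
  \<comment> \<open>As \<open>C\<close> is not tautological, \<open>f\<close> inverts
    \<open>lvar\<close> on \<open>C\<close>. Listing the literals by variable makes the axiom
    syntactically equal to the formula of the clause; \<open>id\<close> serves as \<open>V\<close>
    because nothing is merged yet.\<close>
  define f where "f v = (if Pos v \<in> C then Pos v else Neg v)" for v
  define ls where "ls = map f (sorted_list_of_set (lvar ` C))"
  have f: "f (lvar l) = l" if "l \<in> C" for l
    using that taut[of "lvar l"] by (cases l) (auto simp: f_def)
  have set_ls: "set ls = C"
    using C f by (force simp: ls_def image_image)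
  have inj: "inj f"
    by (auto simp: inj_def f_def split: if_splits)
  have "distinct ls"
    using inj by (auto simp: ls_def distinct_map inj_on_def inj_def)
  then have der: "efrege_red R \<Pi> \<phi> \<Pi>' (L @ [disj ls])"
    using assms set_ls by (intro efrege_red.clause) auto
  have q: "qvar ` Ord ` C = lvar ` C" by (auto simp: image_image)
  have "lit_fm (f v) = litf id (Ord ` C) v" for v
    by (auto simp: f_def litf_def)
  then have eq: "disj ls = bigor (disjuncts id (Ord ` C))"
    by (simp add: disj_def bigor_def disjuncts_def ls_def q comp_def)
  have "line_ok \<Pi> \<Pi>' (L @ [disj ls]) (Ord ` C)"
    unfolding line_ok_def proper_def left_of_def
    using C taut eq q by (intro conjI exI[of _ id]) auto
  moreover have "fsize (disj ls) \<le> 5 * n + 1"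
    unfolding eq by (rule fsize_disjuncts) (use C assms in auto)
  ultimately show ?thesis using der by blast
qed

text \<open>All variables of the formula of a clause are at most as far to the right as the rightmost
  variable of the clause, so that the reduction rule applies to it directly.\<close>

lemma reduction_disjuncts:
  assumes "extends \<Pi> \<Pi>'" "efrege_red R \<Pi> \<phi> \<Pi>' L" "proper \<Pi> K" "left_of \<Pi>' V K"
    and "bigor (disjuncts V K) \<in> set L" "universal \<Pi> u" "u \<in> qvar ` K"
    and "\<forall>k\<in>K. lev \<Pi> (qvar k) \<le> lev \<Pi> u" "B \<in> {Bot, Top}"
  shows "efrege_red R \<Pi> \<phi> \<Pi>' (L @ [subst (Var(u := B)) (bigor (disjuncts V K))])"
    and "\<And>v. v \<in> qvar ` K \<Longrightarrow> Merged v \<in> K \<Longrightarrow> V v \<noteq> u"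
proof -
  have K: "finite K" "qvar ` K \<subseteq> pvars \<Pi>" using assms(3) by (auto simp: proper_def)
  have u: "universal \<Pi>' u" using assms(1,6) by (auto simp: universal_def extends_def)
  have le: "\<not> lev \<Pi>' u < lev \<Pi>' v" if v: "v \<in> qvar ` K" for v
    using v K assms(1,7,8) by (auto simp: extends_def not_less subset_iff)
  \<comment> \<open>\<open>V v\<close> is strictly left of \<open>v\<close>, which is not right of
    \<open>u\<close>. This also shows \<open>V v \<noteq> u\<close>, so that setting
    \<open>u\<close> changes no disjunct but its own.\<close>
  have less: "lev \<Pi>' (V v) < lev \<Pi>' u" if v: "Merged v \<in> K" for v
    using assms(4) le[of v] v image_eqI[of v qvar "Merged v"] by (fastforce simp: left_of_def)
  have "u \<in> vars (bigor (disjuncts V K))"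
    using assms(7) K by (auto simp: vars_bigor set_disjuncts vars_litf)
  moreover have "\<forall>x\<in>vars (bigor (disjuncts V K)). \<not> lev \<Pi>' u < lev \<Pi>' x"
    using le less K by (auto simp: vars_bigor set_disjuncts vars_litf dest: less_asym split: if_splits)
  ultimately show "efrege_red R \<Pi> \<phi> \<Pi>' (L @ [subst (Var(u := B)) (bigor (disjuncts V K))])"
    using efrege_red.reduction[OF assms(2,5) u] assms(9) by blast
  show "\<And>v. v \<in> qvar ` K \<Longrightarrow> Merged v \<in> K \<Longrightarrow> V v \<noteq> u"
    using less by blast
qed

lemma vars_subst_const: "vars B = {} \<Longrightarrow> vars (subst (Var(u := B)) F) \<subseteq> vars F"
  by (auto simp: vars_subst split: if_splits)

lemma disjuncts_reduced:
  assumes "finite K" "d \<in> set (map (subst (Var(u := B))) (disjuncts V K))"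
    and "\<And>v. v \<in> qvar ` K \<Longrightarrow> Merged v \<in> K \<Longrightarrow> V v \<noteq> u"
  shows "d = subst (Var(u := B)) (litf V K u) \<or> (\<exists>v\<in>qvar ` K. v \<noteq> u \<and> d = litf V K v)"
proof -
  obtain v where v: "v \<in> qvar ` K" "d = subst (Var(u := B)) (litf V K v)"
    using assms(1,2) by (auto simp: set_disjuncts)
  then show ?thesis using litf_subst[of v u K V B] assms(3)[of v] by (cases "v = u") auto
qed

lemma proper_subset: "proper \<Pi> K \<Longrightarrow> D \<subseteq> K \<Longrightarrow> proper \<Pi> D"
  unfolding proper_def by (meson finite_subset image_mono subset_trans subsetD)

text \<open>Agreement of \<open>C\<close> and \<open>C'\<close> prevents the other premise from
  changing the literal on \<open>v\<close>. The alternative \<open>Merged v \<in> K'\<close> covers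
  a pivot variable that also occurs merged: the formula then omits the pivot literal, and the merged
  disjunct must pass to the resolvent.\<close>

lemma litf_resolvent:
  assumes K': "K' = C \<union> U \<union> {Ord p}" and K: "K = C \<union> C' \<union> Merged ` qvar ` U"
    and v: "v \<in> qvar ` K'" "v \<notin> qvar ` U" "v \<noteq> lvar p \<or> Merged v \<in> K'"
    and agree: "\<forall>l\<in>C. \<forall>l'\<in>C'. qvar l = v \<longrightarrow> qvar l' = v \<longrightarrow> l = l' \<and> l \<noteq> Merged v"
    and V: "Merged v \<in> K' \<Longrightarrow> V v = V' v"
  shows "v \<in> qvar ` K \<and> litf V' K' v = litf V K v"
proof (cases "Merged v \<in> K'")
  case True
  then have "Merged v \<in> C" using v(2) image_eqI[of v qvar "Merged v" U] by (auto simp: K')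
  then have "Merged v \<in> K" by (simp add: K)
  then show ?thesis using True V image_eqI[of v qvar "Merged v" K] by (simp add: litf_def)
next
  case False
  have in_C: "l \<in> K' \<longleftrightarrow> l \<in> C" if "qvar l = v" for l
    using that v(2,3) False by (auto simp: K')
  obtain k where k: "k \<in> C" "qvar k = v" using v(1) in_C by auto
  have "l \<in> K' \<longleftrightarrow> l \<in> K" if l: "qvar l = v" for l
  proof
    assume "l \<in> K"
    then consider "l \<in> C" | "l \<in> C'" | "l \<in> Merged ` qvar ` U" by (auto simp: K)
    then show "l \<in> K'"
    proof cases
      case 2
      then have "k = l" using agree k l by blast
      then show ?thesis using k in_C by blast
    qed (use l v(2) in_C in auto)
  qed (use in_C[OF l] K in auto)
  then have "litf V' K' v = litf V K v" using False by (intro litf_cong) auto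
  moreover have "v \<in> qvar ` K" using k by (auto simp: K)
  ultimately show ?thesis by blast
qed

text \<open>With merged literals read as pairs, a variable shared by \<open>C1\<close> and
  \<open>C2\<close> must carry the same ordinary literal in both. SR is therefore LR with nothing to
  merge, and one simulation covers both.\<close>

lemma sr_cond_imp_lr_cond: "sr_cond C1 C2 \<Longrightarrow> lr_cond \<Pi> x C1 {} C2 {}"
  unfolding lr_cond_def
proof (intro conjI ballI allI impI)
  fix l1 l2 z
  assume sr: "sr_cond C1 C2" and l: "l1 \<in> C1" "l2 \<in> C2" "qvar l1 = z \<and> qvar l2 = z"
  have *: "compl a \<notin> lits_of l2" if "a \<in> lits_of l1" for a
    using sr l that by (auto simp: sr_cond_def)
  have "l1 = Merged z \<or> l1 = Ord (Pos z) \<or> l1 = Ord (Neg z)"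
    "l2 = Merged z \<or> l2 = Ord (Pos z) \<or> l2 = Ord (Neg z)"
    using qlit_cases[of l1] qlit_cases[of l2] l(3) by auto
  then show "l1 = l2" "l2 \<noteq> Merged z"
    using *[of "Pos z"] *[of "Neg z"] by auto
qed auto

lemma add_line:
  assumes "efrege_red R \<Pi> \<phi> \<Pi>' L" "extends \<Pi> \<Pi>'" "\<forall>K\<in>set Cs. line_ok \<Pi> \<Pi>' L K"
    "efrege_size L \<le> length Cs * k"
    and "efrege_red R \<Pi> \<phi> \<Pi>'' (L @ L')" "extends \<Pi>' \<Pi>''" "line_ok \<Pi> \<Pi>'' (L @ L') K"
    "efrege_size L' \<le> k"
  shows "\<exists>\<Pi>' L. efrege_red R \<Pi> \<phi> \<Pi>' L \<and> extends \<Pi> \<Pi>' \<and> (\<forall>K\<in>set (Cs @ [K]). line_ok \<Pi> \<Pi>' L K) \<and>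
           efrege_size L \<le> length (Cs @ [K]) * k"
  using assms extends_trans[OF assms(2,6)] line_ok_extends[OF _ assms(2,6)]
  by (intro exI[of _ \<Pi>''] exI[of _ "L @ L'"]) auto

text \<open>Here \<open>n\<close> bounds the literals of a clause. The term
  \<open>20 * n + 20\<close> pays for lines that are not Frege inferences: an axiom, one or two
  reduced disjunctions of size at most \<open>5 * n + 1\<close>, or up to \<open>n\<close> extension
  lines of size 10. The factor \<open>5 * n + 20\<close> bounds the substituted formulas, with some
  slack.\<close>

definition step_cost :: "nat \<Rightarrow> nat \<Rightarrow> nat" where
  "step_cost c n = 20 * n + 20 + c * (5 * n + 20) * (6 * n ^ 2 + 10 * n + 5)"

text \<open>The cost \<open>(3 * n + 4) * (c * m)\<close> per disjunct is set by the most expensive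
  kind, the one merged in a resolution: three premises charged \<open>(n + 1) * (c * m)\<close>
  each, and one inference.\<close>

lemma two_bigors_cost:
  "2 * (n * ((3 * n + 4) * (c * m) + c * m) + 2 * c * m) + c * m = c * m * (6 * n ^ 2 + 10 * n + 5)"
  for c m n :: nat
  by (simp add: algebra_simps power2_eq_square)

section \<open>Cost-bounded simulation of reduction and resolution\<close>

context frege_cost
begin

lemma prov_contradiction:
  assumes "vars (Imp p E) \<subseteq> X" "fsize p \<le> m" "fsize E \<le> m"
  shows "prov R X G (c * m) (Imp (Not p) (Imp p E))" "prov R X G (c * m) (Imp p (Imp (Not p) E))"
  using prov_rule[of "[]" "Imp (Not (Var 0)) (Imp (Var 0) (Var 1))" "[p, E]" X m G 0]
    prov_rule[of "[]" "Imp (Var 0) (Imp (Not (Var 0)) (Var 1))" "[p, E]" X m G 0]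
    assms fsize_pos[of p]
  by (auto simp: schema_simps)

lemma prov_not_iff_const:
  assumes "vars (Imp p E) \<subseteq> X" "fsize p \<le> m" "fsize E \<le> m"
  shows "prov R X G (c * m) (Imp (Not (Iff Top p)) (Imp p E))"
    and "prov R X G (c * m) (Imp (Not (Iff Bot p)) (Imp (Not p) E))"
  using prov_rule[of "[]" "Imp (Not (Iff Top (Var 0))) (Imp (Var 0) (Var 1))" "[p, E]" X m G 0]
    prov_rule[of "[]" "Imp (Not (Iff Bot (Var 0))) (Imp (Not (Var 0)) (Var 1))" "[p, E]" X m G 0]
    assms fsize_pos[of p]
  by (auto simp: schema_simps)

lemma prov_litf_falsifier:
  assumes "v \<in> X" "vars (litf V K v) \<subseteq> X" "1 \<le> m"
  shows "prov R X G (c * m) (Imp (litf V K v) (Not (Iff (Var v) (falsifier V K v))))"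
  using prov_rule[of "[]" "Imp (Var 0) (Var 0)" "[Not (Iff (Var v) (Var (V v)))]" X m G 0]
    prov_rule[of "[]" "Imp (Var 0) (Not (Iff (Var 0) Bot))" "[Var v]" X m G 0]
    prov_rule[of "[]" "Imp (Not (Var 0)) (Not (Iff (Var 0) Top))" "[Var v]" X m G 0]
    prov_rule[of "[]" "Imp (Not (Iff (Var 0) (Var 1))) (Not (Iff (Var 0) (Var 1)))"
      "[Var v, Var (V v)]" X m G 0]
    assms
  by (auto simp: schema_simps litf_def falsifier_def)

lemma triple: "3 * N = N + (N + N)" for N :: nat
  by simp

text \<open>Under \<open>x\<close> the definition makes \<open>e\<close> equal to \<open>w1\<close>,
  so that \<open>Not (Iff u w1)\<close> turns into \<open>Not (Iff u e)\<close>; under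
  \<open>Not x\<close> the same happens with \<open>w2\<close>.\<close>

lemma prov_merge:
  assumes ext: "Iff e (Or (And x w1) (And (Not x) w2)) \<in> G"
    and E: "prov R X G N (Imp (Not (Iff u e)) E)"
    and vs: "vars e \<union> vars x \<union> vars w1 \<union> vars w2 \<union> vars d \<union> vars u \<union> vars E \<subseteq> X"
    and sz: "\<forall>F\<in>{e, x, w1, w2, d, u, E}. fsize F \<le> m"
  shows "prov R X G N (Imp d (Not (Iff u w1))) \<Longrightarrow> prov R X G (3 * N + c * m) (Imp d (Imp x E))"
    and "prov R X G N (Imp d (Not (Iff u w2))) \<Longrightarrow> prov R X G (3 * N + c * m) (Imp d (Imp (Not x) E))"
  using prov_rule[of "[Iff (Var 0) (Or (And (Var 1) (Var 2)) (And (Not (Var 1)) (Var 3))),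
        Imp (Not (Iff (Var 5) (Var 0))) (Var 6), Imp (Var 4) (Not (Iff (Var 5) (Var 2)))]"
      "Imp (Var 4) (Imp (Var 1) (Var 6))" "[e, x, w1, w2, d, u, E]" X m G N]
    prov_rule[of "[Iff (Var 0) (Or (And (Var 1) (Var 2)) (And (Not (Var 1)) (Var 3))),
        Imp (Not (Iff (Var 5) (Var 0))) (Var 6), Imp (Var 4) (Not (Iff (Var 5) (Var 3)))]"
      "Imp (Var 4) (Imp (Not (Var 1)) (Var 6))" "[e, x, w1, w2, d, u, E]" X m G N]
    assms fsize_pos[of e] prov_hyp[OF ext, of R X N]
  by (auto simp: schema_simps triple)

lemma simulate_red:
  assumes ext: "extends \<Pi> \<Pi>'" and der: "efrege_red R \<Pi> \<phi> \<Pi>' L"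
    and ok: "line_ok \<Pi> \<Pi>' L (D \<union> {Ord l})" and uni: "universal \<Pi> (lvar l)"
    and lev: "\<forall>k\<in>D. lev \<Pi> (qvar k) \<le> lev \<Pi> (lvar l)" and n: "card (D \<union> {Ord l}) \<le> n"
  shows "\<exists>L'. efrege_red R \<Pi> \<phi> \<Pi>' (L @ L') \<and> line_ok \<Pi> \<Pi>' (L @ L') D \<and>
           efrege_size L' \<le> step_cost c n"
proof -
  let ?K = "D \<union> {Ord l}" and ?u = "lvar l"
  obtain V where pK: "proper \<Pi> ?K" and left: "left_of \<Pi>' V ?K" and F: "bigor (disjuncts V ?K) \<in> set L"
    using ok by (auto simp: line_ok_def)
  have K: "finite ?K" "qvar ` ?K \<subseteq> pvars \<Pi>'"
    using pK extends_pvars[OF ext] unfolding proper_def by blast+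
  have propD: "proper \<Pi> D" and leftD: "left_of \<Pi>' V D" and D: "finite D" "card D \<le> n"
    using proper_subset[OF pK, of D] left K(1) n card_mono[OF K(1), of D]
    by (auto simp: left_of_def subset_insertI)
  show ?thesis
  \<comment> \<open>If a merged literal on this variable or \<open>l\<close> itself remains in
    \<open>D\<close>, both clauses have the same disjuncts and the old line already serves.\<close>
  proof (cases "Merged ?u \<in> D \<or> Ord l \<in> D")
    case True
    have "disjuncts V D = disjuncts V ?K"
    proof (cases "Ord l \<in> D")
      case True
      then show ?thesis by (simp add: insert_absorb)
    next
      case False
      then have m: "Merged ?u \<in> D" using True by simp
      have "qvar ` ?K = qvar ` D" using image_eqI[OF _ m, of ?u qvar] by auto
      moreover have "litf V D v = litf V ?K v" for v
        using m by (cases l) (auto simp: litf_def)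
      ultimately show ?thesis by (simp add: disjuncts_def)
    qed
    then show ?thesis using F der propD leftD
      by (intro exI[of _ "[]"]) (auto simp: line_ok_def)
  next
    case False
    have u: "?u \<notin> qvar ` D"
    proof
      assume "?u \<in> qvar ` D"
      then obtain k where "k \<in> D" "qvar k = ?u" by auto
      then have "Merged ?u \<in> D \<or> Ord (Pos ?u) \<in> D \<or> Ord (Neg ?u) \<in> D"
        using qlit_cases[of k] by metis
      then show False using False pK by (cases l) (auto simp: proper_def)
    qed
    \<comment> \<open>The constant falsifying \<open>l\<close>: its disjunct becomes
      \<open>Bot\<close> or \<open>Not Top\<close>, from which anything follows.\<close>
    define B :: fm where "B = (case l of Pos _ \<Rightarrow> Bot | Neg _ \<Rightarrow> Top)"
    have B: "B \<in> {Bot, Top}" "vars B = {}" "fsize B = 1" by (auto simp: B_def split: lit.split)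
    let ?\<tau> = "Var(?u := B)"
    let ?F = "bigor (disjuncts V ?K)" and ?E = "bigor (disjuncts V D)"
    let ?ds = "map (subst ?\<tau>) (disjuncts V ?K)"
    let ?m = "5 * n + 20"
    have red: "efrege_red R \<Pi> \<phi> \<Pi>' (L @ [subst ?\<tau> ?F])"
      and neq: "\<And>v. v \<in> qvar ` ?K \<Longrightarrow> Merged v \<in> ?K \<Longrightarrow> V v \<noteq> ?u"
      using reduction_disjuncts[OF ext der pK left F uni _ _ B(1)] lev by auto
    have eq: "subst ?\<tau> ?F = bigor ?ds" by (rule subst_bigor)
    have vE: "vars ?E \<subseteq> pvars \<Pi>'" and sE: "fsize ?E \<le> ?m"
      using vars_disjuncts[OF D(1) _ leftD] fsize_disjuncts[OF D, of V] K(2) by auto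
    have vF: "vars (bigor ?ds) \<subseteq> pvars \<Pi>'" and sF: "fsize (bigor ?ds) \<le> 5 * n + 1"
      using vars_disjuncts[OF K left] fsize_disjuncts[OF K(1) n, of V]
        subset_trans[OF vars_subst_const[OF B(2)] vars_disjuncts[OF K left]]
        fsize_subst_const[OF B(3), of ?u ?F]
      unfolding eq[symmetric] by auto
    let ?G = "set (L @ [subst ?\<tau> ?F])"
    have "prov R (pvars \<Pi>') ?G ((3 * n + 4) * (c * ?m)) (Imp d ?E)" if d: "d \<in> set ?ds" for d
    proof -
      consider "d = subst ?\<tau> (litf V ?K ?u)" | v where "v \<in> qvar ` ?K" "v \<noteq> ?u" "d = litf V ?K v"
        using disjuncts_reduced[OF K(1) d neq] by blast
      then show ?thesis
      proof cases
        case 1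
        have "Merged ?u \<notin> ?K" using False by auto
        moreover have "Ord (Pos ?u) \<notin> ?K" if "l = Neg ?u"
          using that pK by (auto simp: proper_def)
        ultimately have "d = Bot \<or> d = Not Top"
          using 1 by (cases l) (auto simp: litf_def B_def)
        then have "prov R (pvars \<Pi>') ?G (c * ?m) (Imp d ?E)"
          using prov_bot[OF vE sE] prov_not_top[OF vE sE] by auto
        then show ?thesis by (rule prov_mono) auto
      next
        case 2
        have "litf V ?K v = litf V D v" using 2(2) by (intro litf_cong) auto
        then have "d \<in> set (disjuncts V D)" using 2 D(1) by (auto simp: set_disjuncts)
        then have "prov R (pvars \<Pi>') ?G (length (disjuncts V D) * (c * ?m)) (Imp d ?E)"
          by (rule prov_bigor_intro[OF _ vE sE])
        then show ?thesis
          by (rule prov_mono) (use length_disjuncts[OF D(1), of V] D(2) in \<open>auto intro!: mult_le_mono1\<close>)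
      qed
    qed
    then have "prov R (pvars \<Pi>') ?G (n * ((3 * n + 4) * (c * ?m) + c * ?m) + 2 * c * ?m) ?E"
      using length_disjuncts[OF K(1), of V] n sF
      by (intro prov_bigor_cases[OF _ _ vF vE _ sE]) (auto simp: subst_bigor)
    then obtain L' where L': "efrege_red R \<Pi> \<phi> \<Pi>' ((L @ [subst ?\<tau> ?F]) @ L')"
        "?E \<in> set ((L @ [subst ?\<tau> ?F]) @ L')"
        "efrege_size L' \<le> n * ((3 * n + 4) * (c * ?m) + c * ?m) + 2 * c * ?m"
      using efrege_red_prov[OF red] by blast
    have "efrege_size ([subst ?\<tau> ?F] @ L') \<le> step_cost c n"
      using L'(3) sF two_bigors_cost[of n c ?m] by (simp add: subst_bigor step_cost_def)
    then show ?thesis using L' propD leftD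
      by (intro exI[of _ "[subst ?\<tau> ?F] @ L'"]) (auto simp: line_ok_def)
  qed
qed

text \<open>An ordinary literal on \<open>u\<close> that remains in \<open>D\<close> was suppressed
  in the old formula and appears in the new one. This only weakens the disjunction, so it needs no
  treatment of its own.\<close>

lemma simulate_red_merged:
  assumes ext: "extends \<Pi> \<Pi>'" and der: "efrege_red R \<Pi> \<phi> \<Pi>' L"
    and ok: "line_ok \<Pi> \<Pi>' L (D \<union> {Merged u})" and uni: "universal \<Pi> u"
    and lev: "\<forall>k\<in>D. lev \<Pi> (qvar k) \<le> lev \<Pi> u" and n: "card (D \<union> {Merged u}) \<le> n"
  shows "\<exists>L'. efrege_red R \<Pi> \<phi> \<Pi>' (L @ L') \<and> line_ok \<Pi> \<Pi>' (L @ L') D \<and>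
           efrege_size L' \<le> step_cost c n"
proof (cases "Merged u \<in> D")
  case True
  then show ?thesis using der ok
    by (intro exI[of _ "[]"]) (auto simp: insert_absorb)
next
  case False
  let ?K = "D \<union> {Merged u}"
  obtain V where pK: "proper \<Pi> ?K" and left: "left_of \<Pi>' V ?K" and F: "bigor (disjuncts V ?K) \<in> set L"
    using ok by (auto simp: line_ok_def)
  have K: "finite ?K" "qvar ` ?K \<subseteq> pvars \<Pi>'"
    using pK extends_pvars[OF ext] unfolding proper_def by blast+
  have propD: "proper \<Pi> D" and leftD: "left_of \<Pi>' V D" and D: "finite D" "card D \<le> n"
    using proper_subset[OF pK, of D] left K(1) n card_mono[OF K(1), of D]
    by (auto simp: left_of_def subset_insertI)
  let ?F = "bigor (disjuncts V ?K)" and ?E = "bigor (disjuncts V D)"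
  let ?m = "5 * n + 20" and ?p = "Var (V u)" and ?N = "(3 * n + 4) * (c * (5 * n + 20))"
  define ds where "ds B = map (subst (Var(u := B))) (disjuncts V ?K)" for B
  have eq: "subst (Var(u := B)) ?F = bigor (ds B)" for B by (simp add: ds_def subst_bigor)
  define G where "G = set (L @ [bigor (ds Bot)] @ [bigor (ds Top)])"
  have lev': "\<forall>k\<in>?K. lev \<Pi> (qvar k) \<le> lev \<Pi> u" and uK: "u \<in> qvar ` ?K" using lev by auto
  have red1: "efrege_red R \<Pi> \<phi> \<Pi>' (L @ [bigor (ds Bot)])"
    using reduction_disjuncts(1)[OF ext der pK left F uni uK lev', of Bot] unfolding eq by simp
  have neq: "V v \<noteq> u" if "v \<in> qvar ` ?K" "Merged v \<in> ?K" for v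
    using reduction_disjuncts(2)[OF ext der pK left F uni uK lev', of Bot] that by blast
  have red2: "efrege_red R \<Pi> \<phi> \<Pi>' (L @ [bigor (ds Bot)] @ [bigor (ds Top)])"
    using reduction_disjuncts(1)[OF ext red1 pK left _ uni uK lev', of Top] F unfolding eq by simp
  have vE: "vars ?E \<subseteq> pvars \<Pi>'" and sE: "fsize ?E \<le> 5 * n + 1"
    using vars_disjuncts[OF D(1) _ leftD] fsize_disjuncts[OF D, of V] K(2) by auto
  have vF: "vars (bigor (ds B)) \<subseteq> pvars \<Pi>'" and sF: "fsize (bigor (ds B)) \<le> 5 * n + 1"
    if B: "B \<in> {Bot, Top}" for B
  proof -
    have "vars B = {}" "fsize B = 1" using B by auto
    then show "vars (bigor (ds B)) \<subseteq> pvars \<Pi>'" "fsize (bigor (ds B)) \<le> 5 * n + 1"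
      using subset_trans[OF vars_subst_const vars_disjuncts[OF K left]]
        fsize_disjuncts[OF K(1) n, of V] fsize_subst_const[of B u ?F]
      unfolding eq[symmetric] by auto
  qed
  have vp: "V u \<in> pvars \<Pi>'"
    using left lev_less_pvars[of \<Pi>' "V u" u] by (auto simp: left_of_def)
  \<comment> \<open>After setting \<open>u\<close> to \<open>Top\<close> the merged disjunct
    contradicts \<open>V u\<close>, after \<open>Bot\<close> it contradicts the negation. The two
    instances are therefore used in opposite branches of the split on \<open>V u\<close>.\<close>
  have disj: "prov R (pvars \<Pi>') G ?N (Imp d (Imp q ?E))"
    if d: "d \<in> set (ds B)" and q: "B = Top \<and> q = ?p \<or> B = Bot \<and> q = Not ?p" for d B q
  proof -
    consider "d = subst (Var(u := B)) (litf V ?K u)"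
      | v where "v \<in> qvar ` ?K" "v \<noteq> u" "d = litf V ?K v"
      using disjuncts_reduced[OF K(1) d[unfolded ds_def] neq] by blast
    then show ?thesis
    proof cases
      case 1
      then have "d = Not (Iff B ?p)" using neq[of u] by (simp add: litf_def)
      then have "prov R (pvars \<Pi>') G (c * ?m) (Imp d (Imp q ?E))"
        using prov_not_iff_const[of ?p ?E "pvars \<Pi>'" ?m G] q vE vp sE by auto
      then show ?thesis by (rule prov_mono) auto
    next
      case 2
      have "litf V ?K v = litf V D v" using 2(2) by (intro litf_cong) auto
      then have d': "d \<in> set (disjuncts V D)" using 2 D(1) by (auto simp: set_disjuncts)
      have "prov R (pvars \<Pi>') G (length (disjuncts V D) * (c * ?m)) (Imp d ?E)"
        by (rule prov_bigor_intro[OF d' vE]) (use sE in auto)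
      then have "prov R (pvars \<Pi>') G (n * (c * ?m)) (Imp d ?E)"
        by (rule prov_mono) (use length_disjuncts[OF D(1), of V] D(2) in \<open>auto intro!: mult_le_mono1\<close>)
      then have "prov R (pvars \<Pi>') G (n * (c * ?m) + c * ?m) (Imp d (Imp q ?E))"
        using vE sE vp q d' fsize_mem_bigor[OF d'] by (intro prov_weaken) (auto simp: vars_bigor)
      then show ?thesis by (rule prov_mono) (auto simp: algebra_simps)
    qed
  qed
  have "prov R (pvars \<Pi>') G (2 * (n * (?N + c * ?m) + 2 * c * ?m) + c * ?m) ?E"
  proof (rule prov_two_bigors[of "ds Top" _ "ds Bot" _ _ ?p])
    show "\<forall>d\<in>set (ds Top). prov R (pvars \<Pi>') G ?N (Imp d (Imp ?p ?E))" using disj by blast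
    show "\<forall>d\<in>set (ds Bot). prov R (pvars \<Pi>') G ?N (Imp d (Imp (Not ?p) ?E))" using disj by blast
    show "length (ds Top) \<le> n" "length (ds Bot) \<le> n"
      using length_disjuncts[OF K(1), of V] n by (auto simp: ds_def)
    show "fsize (bigor (ds Top)) \<le> ?m" "fsize (bigor (ds Bot)) \<le> ?m" using sF[of Top] sF[of Bot] by auto
  qed (use vF vE sE vp in \<open>auto simp: G_def\<close>)
  then obtain L' where L': "efrege_red R \<Pi> \<phi> \<Pi>' ((L @ [bigor (ds Bot)] @ [bigor (ds Top)]) @ L')"
      "?E \<in> set ((L @ [bigor (ds Bot)] @ [bigor (ds Top)]) @ L')"
      "efrege_size L' \<le> 2 * (n * (?N + c * ?m) + 2 * c * ?m) + c * ?m"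
    using efrege_red_prov[OF red2] unfolding G_def by blast
  have "efrege_size ([bigor (ds Bot), bigor (ds Top)] @ L') \<le> step_cost c n"
    using L'(3) sF[of Bot] sF[of Top] unfolding two_bigors_cost by (simp add: step_cost_def)
  then show ?thesis using L' propD leftD
    by (intro exI[of _ "[bigor (ds Bot), bigor (ds Top)] @ L'"]) (auto simp: line_ok_def)
qed

lemma simulate_res:
  assumes ext: "extends \<Pi> \<Pi>'" and der: "efrege_red R \<Pi> \<phi> \<Pi>' L"
    and ok1: "line_ok \<Pi> \<Pi>' L (C1 \<union> U1 \<union> {Ord (Neg x)})" and ok2: "line_ok \<Pi> \<Pi>' L (C2 \<union> U2 \<union> {Ord (Pos x)})"
    and lr: "lr_cond \<Pi> x C1 U1 C2 U2"
    and n: "card (C1 \<union> U1 \<union> {Ord (Neg x)}) \<le> n" "card (C2 \<union> U2 \<union> {Ord (Pos x)}) \<le> n"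
      "card (C1 \<union> C2 \<union> Merged ` qvar ` U1) \<le> n"
  shows "\<exists>\<Pi>'' L'. efrege_red R \<Pi> \<phi> \<Pi>'' (L @ L') \<and> extends \<Pi>' \<Pi>'' \<and>
           line_ok \<Pi> \<Pi>'' (L @ L') (C1 \<union> C2 \<union> Merged ` qvar ` U1) \<and> efrege_size L' \<le> step_cost c n"
proof -
  define K1 where "K1 = C1 \<union> U1 \<union> {Ord (Neg x)}"
  define K2 where "K2 = C2 \<union> U2 \<union> {Ord (Pos x)}"
  define S where "S = qvar ` U1"
  define K where "K = C1 \<union> C2 \<union> Merged ` S"
  obtain V1 where V1: "proper \<Pi> K1" "left_of \<Pi>' V1 K1" "bigor (disjuncts V1 K1) \<in> set L"
    using ok1 by (auto simp: line_ok_def K1_def)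
  obtain V2 where V2: "proper \<Pi> K2" "left_of \<Pi>' V2 K2" "bigor (disjuncts V2 K2) \<in> set L"
    using ok2 by (auto simp: line_ok_def K2_def)
  have K1: "finite K1" "qvar ` K1 \<subseteq> pvars \<Pi>" "card K1 \<le> n"
    and K2: "finite K2" "qvar ` K2 \<subseteq> pvars \<Pi>" "card K2 \<le> n"
    using V1(1) V2(1) n unfolding proper_def K1_def K2_def by blast+
  have sub: "pvars \<Pi> \<subseteq> pvars \<Pi>'" by (rule extends_pvars[OF ext])
  have S2: "S = qvar ` U2" using lr by (simp add: lr_cond_def S_def)
  have "S \<subseteq> qvar ` K1" unfolding S_def K1_def by auto
  moreover have "S \<subseteq> qvar ` K2" unfolding S2 K2_def by auto
  ultimately have SK: "S \<subseteq> qvar ` K1" "S \<subseteq> qvar ` K2" .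
  have x: "x \<in> qvar ` K1" using image_eqI[of x qvar "Ord (Neg x)"] by (auto simp: K1_def)
  have agree: "l1 = l2 \<and> l2 \<noteq> Merged v" if "l1 \<in> C1" "l2 \<in> C2" "qvar l1 = v" "qvar l2 = v" for l1 l2 v
  proof -
    have "\<forall>l1\<in>C1. \<forall>l2\<in>C2. \<forall>z. qvar l1 = z \<and> qvar l2 = z \<longrightarrow> l1 = l2 \<and> l2 \<noteq> Merged z"
      using lr unfolding lr_cond_def by (rule conjunct1)
    then show ?thesis using that by blast
  qed
  have finS: "finite S" and cardS: "card S \<le> n"
  proof -
    show "finite S" using K1(1) by (simp add: S_def K1_def)
    have "card S \<le> card (qvar ` K1)" using SK K1 by (intro card_mono) auto
    also have "\<dots> \<le> n" using card_image_le[OF K1(1), of qvar] K1(3) by simp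
    finally show "card S \<le> n" .
  qed
  have K: "finite K" "qvar ` K \<subseteq> pvars \<Pi>" "card K \<le> n"
    using K1 K2 SK finS n(3) by (auto simp: K_def S_def K1_def K2_def)
  \<comment> \<open>Neither premise contains a complementary pair, and the agreement of
    \<open>C1\<close> and \<open>C2\<close> rules out one formed across them.\<close>
  have propK: "proper \<Pi> K"
    unfolding proper_def
  proof (intro conjI K allI)
    fix v
    show "\<not> (Ord (Pos v) \<in> K \<and> Ord (Neg v) \<in> K)"
      using V1(1) V2(1) agree[of "Ord (Pos v)" "Ord (Neg v)" v] agree[of "Ord (Neg v)" "Ord (Pos v)" v]
      by (auto simp: proper_def K_def K1_def K2_def)
  qed
  \<comment> \<open>The premise \<open>K1\<close> contains the negated pivot, so its other literals
    are needed exactly when \<open>x\<close> holds; its falsifying value therefore goes with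
    \<open>x\<close> and that of \<open>K2\<close> with the negation. The size of \<open>A u\<close>
    is 8.\<close>
  define A where "A u = Or (And (Var x) (falsifier V1 K1 u)) (And (Not (Var x)) (falsifier V2 K2 u))" for u
  have low: "\<forall>u\<in>S. \<forall>a\<in>vars (A u). lev \<Pi>' a < lev \<Pi>' u"
  proof (intro ballI)
    fix u a assume u: "u \<in> S" and a: "a \<in> vars (A u)"
    have "\<forall>u\<in>S. lev \<Pi> x < lev \<Pi> u"
      using lr unfolding lr_cond_def S_def by (elim conjE)
    then have "lev \<Pi> x < lev \<Pi> u" using u by blast
    moreover have "x \<in> pvars \<Pi>" "u \<in> pvars \<Pi>" using x u K1(2) SK by auto
    ultimately have "lev \<Pi>' x < lev \<Pi>' u" using ext by (simp add: extends_def)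
    then show "lev \<Pi>' a < lev \<Pi>' u"
      using a V1(2) V2(2) by (auto simp: A_def falsifier_def left_of_def split: if_splits)
  qed
  have "distinct (map snd \<Pi>')" "S \<subseteq> pvars \<Pi>'" "\<forall>u\<in>S. fsize (A u) \<le> 8"
    using ext SK K1(2) sub by (auto simp: extends_def A_def falsifier_def)
  then obtain \<Pi>'' L1 e where e: "efrege_red R \<Pi> \<phi> \<Pi>'' (L @ L1)" "extends \<Pi>' \<Pi>''"
      "\<forall>u\<in>S. lev \<Pi>'' (e u) < lev \<Pi>'' u \<and> Iff (Var (e u)) (A u) \<in> set L1"
      "efrege_size L1 \<le> card S * (8 + 2)"
    using add_extensions_left_of[OF finS der _ _ low, of 8] by blast
  have sub': "pvars \<Pi>' \<subseteq> pvars \<Pi>''" by (rule extends_pvars[OF e(2)])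
  have left1: "left_of \<Pi>'' V1 K1" and left2: "left_of \<Pi>'' V2 K2"
    using left_of_extends[OF V1(2) _ e(2)] left_of_extends[OF V2(2) _ e(2)] K1 K2 sub by auto
  \<comment> \<open>Outside \<open>S\<close> a variable is merged in at most one premise, because
    \<open>agree\<close> forbids a merged literal common to \<open>C1\<close> and \<open>C2\<close>;
    the choice between \<open>V1\<close> and \<open>V2\<close> never conflicts.\<close>
  define V where "V u = (if u \<in> S then e u else if Merged u \<in> K1 then V1 u else V2 u)" for u
  have leftK: "left_of \<Pi>'' V K"
    using left1 left2 e(3) by (auto simp: left_of_def V_def K_def K1_def K2_def)
  let ?X = "pvars \<Pi>''" and ?G = "set (L @ L1)" and ?m = "5 * n + 20" and ?E = "bigor (disjuncts V K)"
  let ?N = "(3 * n + 4) * (c * (5 * n + 20))"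
  have vE: "vars ?E \<subseteq> ?X" and sE: "fsize ?E \<le> 5 * n + 1"
    using vars_disjuncts[OF K(1) _ leftK] fsize_disjuncts[OF K(1,3), of V] K(2) sub sub' by auto
  have v1: "vars (bigor (disjuncts V1 K1)) \<subseteq> ?X" and s1: "fsize (bigor (disjuncts V1 K1)) \<le> 5 * n + 1"
    using vars_disjuncts[OF K1(1) _ left1] fsize_disjuncts[OF K1(1,3), of V1] K1(2) sub sub' by auto
  have v2: "vars (bigor (disjuncts V2 K2)) \<subseteq> ?X" and s2: "fsize (bigor (disjuncts V2 K2)) \<le> 5 * n + 1"
    using vars_disjuncts[OF K2(1) _ left2] fsize_disjuncts[OF K2(1,3), of V2] K2(2) sub sub' by auto
  have xX: "x \<in> ?X" using x K1(2) sub sub' by auto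
  have intro: "prov R ?X ?G (n * (c * ?m)) (Imp (litf V K v) ?E)" if "v \<in> qvar ` K" for v
  proof -
    have "prov R ?X ?G (length (disjuncts V K) * (c * ?m)) (Imp (litf V K v) ?E)"
      using that K(1) sE by (intro prov_bigor_intro[OF _ vE]) (auto simp: set_disjuncts)
    then show ?thesis
      by (rule prov_mono) (use length_disjuncts[OF K(1), of V] K(3) in \<open>auto intro!: mult_le_mono1\<close>)
  qed
  have copy: "prov R ?X ?G ?N (Imp (litf V K v) (Imp q ?E))"
    if "v \<in> qvar ` K" "q = Var x \<or> q = Not (Var x)" for v q
  proof -
    have "vars (litf V K v) \<subseteq> ?X"
      using vE that(1) K(1) by (auto simp: vars_bigor set_disjuncts)
    then have "prov R ?X ?G (n * (c * ?m) + c * ?m) (Imp (litf V K v) (Imp q ?E))"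
      using that vE sE xX fsize_litf[of V K v] by (intro prov_weaken intro) auto
    then show ?thesis by (rule prov_mono) (auto simp: algebra_simps)
  qed
  have merged: "prov R ?X ?G ?N (Imp (litf V1 K1 v) (Imp (Var x) ?E))"
    "prov R ?X ?G ?N (Imp (litf V2 K2 v) (Imp (Not (Var x)) ?E))" if v: "v \<in> S" for v
  proof -
    have m: "Merged v \<in> K" "v \<in> qvar ` K" using v image_eqI[of v qvar "Merged v" K] by (auto simp: K_def)
    have vX: "v \<in> ?X" using v SK K1(2) sub sub' by blast
    have eX: "e v \<in> ?X" using e(3) v lev_less_pvars by blast
    have Iff: "Iff (Var (e v)) (A v) \<in> ?G" using e(3) v by auto
    have "litf V K v = Not (Iff (Var v) (Var (e v)))" using m(1) v by (simp add: litf_def V_def)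
    then have E: "prov R ?X ?G ((n + 1) * (c * ?m)) (Imp (Not (Iff (Var v) (Var (e v)))) ?E)"
      using intro[OF m(2)] by (auto elim!: prov_mono)
    have "v \<in> qvar ` K1" "v \<in> qvar ` K2" using v SK by blast+
    then have l1: "vars (litf V1 K1 v) \<subseteq> ?X" and l2: "vars (litf V2 K2 v) \<subseteq> ?X"
      using v1 v2 by (simp_all only: vars_bigor set_disjuncts[OF K1(1)] set_disjuncts[OF K2(1)]) blast+
    have w: "vars (falsifier V1 K1 v) \<subseteq> ?X" "vars (falsifier V2 K2 v) \<subseteq> ?X"
      using l1 l2 by (auto simp: falsifier_def vars_litf)
    have sw: "fsize (falsifier V' K' v) \<le> ?m" "fsize (litf V' K' v) \<le> ?m" for V' K'
      using fsize_litf[of V' K' v] by (auto simp: falsifier_def)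
    have f1: "prov R ?X ?G ((n + 1) * (c * ?m)) (Imp (litf V1 K1 v) (Not (Iff (Var v) (falsifier V1 K1 v))))"
      by (rule prov_mono[OF prov_litf_falsifier[OF vX l1, of ?m]]) auto
    have f2: "prov R ?X ?G ((n + 1) * (c * ?m)) (Imp (litf V2 K2 v) (Not (Iff (Var v) (falsifier V2 K2 v))))"
      by (rule prov_mono[OF prov_litf_falsifier[OF vX l2, of ?m]]) auto
    have "prov R ?X ?G (3 * ((n + 1) * (c * ?m)) + c * ?m) (Imp (litf V1 K1 v) (Imp (Var x) ?E))"
      by (rule prov_merge(1)[OF Iff[unfolded A_def] E _ _ f1]) (use eX xX vX w l1 vE sE sw in auto)
    then show "prov R ?X ?G ?N (Imp (litf V1 K1 v) (Imp (Var x) ?E))"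
      by (rule prov_mono) (auto simp: algebra_simps)
    have "prov R ?X ?G (3 * ((n + 1) * (c * ?m)) + c * ?m) (Imp (litf V2 K2 v) (Imp (Not (Var x)) ?E))"
      by (rule prov_merge(2)[OF Iff[unfolded A_def] E _ _ f2]) (use eX xX vX w l2 vE sE sw in auto)
    then show "prov R ?X ?G ?N (Imp (litf V2 K2 v) (Imp (Not (Var x)) ?E))"
      by (rule prov_mono) (auto simp: algebra_simps)
  qed
  have contra: "prov R ?X ?G ?N (Imp (Not (Var x)) (Imp (Var x) ?E))"
    "prov R ?X ?G ?N (Imp (Var x) (Imp (Not (Var x)) ?E))"
    using prov_contradiction[of "Var x" ?E ?X ?m ?G] xX vE sE by (auto elim!: prov_mono)
  have H1: "\<forall>d\<in>set (disjuncts V1 K1). prov R ?X ?G ?N (Imp d (Imp (Var x) ?E))"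
  proof
    fix d assume "d \<in> set (disjuncts V1 K1)"
    then obtain v where v: "v \<in> qvar ` K1" "d = litf V1 K1 v" using K1(1) by (auto simp: set_disjuncts)
    consider "v \<in> S" | "v \<notin> S" "v = x" "Merged v \<notin> K1" | "v \<notin> S" "v \<noteq> x \<or> Merged v \<in> K1" by blast
    then show "prov R ?X ?G ?N (Imp d (Imp (Var x) ?E))"
    proof cases
      case 1
      then show ?thesis using merged(1) v by simp
    next
      case 2
      then have "d = Not (Var x)" using v V1(1) by (auto simp: litf_def proper_def K1_def)
      then show ?thesis using contra by simp
    next
      case 3
      have "v \<in> qvar ` K \<and> litf V1 K1 v = litf V K v"
      proof (rule litf_resolvent[OF K1_def, of K C2])
        show "\<forall>l\<in>C1. \<forall>l'\<in>C2. qvar l = v \<longrightarrow> qvar l' = v \<longrightarrow> l = l' \<and> l \<noteq> Merged v"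
          using agree by metis
      qed (use 3 v in \<open>auto simp: K_def S_def V_def\<close>)
      then show ?thesis using copy v by simp
    qed
  qed
  have H2: "\<forall>d\<in>set (disjuncts V2 K2). prov R ?X ?G ?N (Imp d (Imp (Not (Var x)) ?E))"
  proof
    fix d assume "d \<in> set (disjuncts V2 K2)"
    then obtain v where v: "v \<in> qvar ` K2" "d = litf V2 K2 v" using K2(1) by (auto simp: set_disjuncts)
    consider "v \<in> S" | "v \<notin> S" "v = x" "Merged v \<notin> K2" | "v \<notin> S" "v \<noteq> x \<or> Merged v \<in> K2" by blast
    then show "prov R ?X ?G ?N (Imp d (Imp (Not (Var x)) ?E))"
    proof cases
      case 1
      then show ?thesis using merged(2) v by simp
    next
      case 2
      then have "d = Var x" using v by (auto simp: litf_def K2_def)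
      then show ?thesis using contra by simp
    next
      case 3
      have m: "Merged v \<notin> K1" if "Merged v \<in> K2"
        using that 3(1) agree[of "Merged v" "Merged v" v] image_eqI[of v qvar "Merged v" U1]
          image_eqI[of v qvar "Merged v" U2]
        by (auto simp: K1_def K2_def S_def S2[unfolded S_def])
      have "v \<in> qvar ` K \<and> litf V2 K2 v = litf V K v"
      proof (rule litf_resolvent[OF K2_def, of K C1])
        show "\<forall>l\<in>C2. \<forall>l'\<in>C1. qvar l = v \<longrightarrow> qvar l' = v \<longrightarrow> l = l' \<and> l \<noteq> Merged v"
          using agree by metis
      qed (use 3 v m in \<open>auto simp: K_def S2 V_def\<close>)
      then show ?thesis using copy v by simp
    qed
  qed
  have "prov R ?X ?G (2 * (n * (?N + c * ?m) + 2 * c * ?m) + c * ?m) ?E"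
    by (rule prov_two_bigors[OF _ _ H1 H2])
      (use V1(3) V2(3) v1 v2 s1 s2 vE sE xX length_disjuncts[OF K1(1), of V1] K1(3)
        length_disjuncts[OF K2(1), of V2] K2(3) in auto)
  then obtain L2 where L2: "efrege_red R \<Pi> \<phi> \<Pi>'' ((L @ L1) @ L2)" "?E \<in> set ((L @ L1) @ L2)"
      "efrege_size L2 \<le> 2 * (n * (?N + c * ?m) + 2 * c * ?m) + c * ?m"
    using efrege_red_prov[OF e(1)] by blast
  have "efrege_size (L1 @ L2) \<le> step_cost c n"
    using L2(3) e(4) cardS unfolding two_bigors_cost by (simp add: step_cost_def)
  then show ?thesis using L2 e(2) propK leftK
    unfolding S_def[symmetric] K_def[symmetric]
    by (intro exI[of _ \<Pi>''] exI[of _ "L1 @ L2"]) (auto simp: line_ok_def)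
qed

text \<open>All earlier clauses stay in the invariant, since any of them may be a later premise, by
  then over a larger prefix. The bound \<open>n\<close> is fixed for the whole list, so every step
  is charged the same amount.\<close>

lemma simulate:
  assumes closed: "closed_pcnf \<Pi> \<phi>" and "lqu_plus \<Pi> \<phi> Cs" "\<forall>K\<in>set Cs. card K \<le> n"
  shows "\<exists>\<Pi>' L. efrege_red R \<Pi> \<phi> \<Pi>' L \<and> extends \<Pi> \<Pi>' \<and> (\<forall>K\<in>set Cs. line_ok \<Pi> \<Pi>' L K) \<and>
           efrege_size L \<le> length Cs * step_cost c n"
  using assms(2,3)
proof (induction rule: lqu_plus.induct)
  case start
  have "extends \<Pi> \<Pi>" using closed by (intro extends_refl) (simp add: closed_pcnf_def)
  then show ?case using efrege_red.start by fastforce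
next
  case (clause Cs C)
  then obtain \<Pi>' L where IH: "efrege_red R \<Pi> \<phi> \<Pi>' L" "extends \<Pi> \<Pi>'"
    "\<forall>K\<in>set Cs. line_ok \<Pi> \<Pi>' L K" "efrege_size L \<le> length Cs * step_cost c n" by auto
  obtain F where F: "efrege_red R \<Pi> \<phi> \<Pi>' (L @ [F])" "line_ok \<Pi> \<Pi>' (L @ [F]) (Ord ` C)"
    "fsize F \<le> 5 * n + 1"
    using simulate_clause[OF closed IH(1) clause.hyps(2,3)] clause.prems by auto
  then have "efrege_size [F] \<le> step_cost c n" by (simp add: step_cost_def)
  with F(1,2) IH show ?case by (intro add_line[OF IH]) (auto simp: extends_def)
next
  case (red Cs D l)
  then obtain \<Pi>' L where IH: "efrege_red R \<Pi> \<phi> \<Pi>' L" "extends \<Pi> \<Pi>'"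
    "\<forall>K\<in>set Cs. line_ok \<Pi> \<Pi>' L K" "efrege_size L \<le> length Cs * step_cost c n" by auto
  obtain L' where "efrege_red R \<Pi> \<phi> \<Pi>' (L @ L')" "line_ok \<Pi> \<Pi>' (L @ L') D"
    "efrege_size L' \<le> step_cost c n"
    using simulate_red[OF IH(2,1), of D l n] IH(3) red by auto
  then show ?case using IH(2) by (intro add_line[OF IH]) (auto simp: extends_def)
next
  case (red_merged Cs D u)
  then obtain \<Pi>' L where IH: "efrege_red R \<Pi> \<phi> \<Pi>' L" "extends \<Pi> \<Pi>'"
    "\<forall>K\<in>set Cs. line_ok \<Pi> \<Pi>' L K" "efrege_size L \<le> length Cs * step_cost c n" by auto
  obtain L' where "efrege_red R \<Pi> \<phi> \<Pi>' (L @ L')" "line_ok \<Pi> \<Pi>' (L @ L') D"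
    "efrege_size L' \<le> step_cost c n"
    using simulate_red_merged[OF IH(2,1), of D u n] IH(3) red_merged by auto
  then show ?case using IH(2) by (intro add_line[OF IH]) (auto simp: extends_def)
next
  case (res_sr Cs C1 x C2)
  then obtain \<Pi>' L where IH: "efrege_red R \<Pi> \<phi> \<Pi>' L" "extends \<Pi> \<Pi>'"
    "\<forall>K\<in>set Cs. line_ok \<Pi> \<Pi>' L K" "efrege_size L \<le> length Cs * step_cost c n" by auto
  obtain \<Pi>'' L' where "efrege_red R \<Pi> \<phi> \<Pi>'' (L @ L')" "extends \<Pi>' \<Pi>''"
    "line_ok \<Pi> \<Pi>'' (L @ L') (C1 \<union> C2)" "efrege_size L' \<le> step_cost c n"
    using simulate_res[OF IH(2,1), of C1 "{}" x C2 "{}" n] sr_cond_imp_lr_cond[OF res_sr.hyps(4)]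
      IH(3) res_sr by auto
  then show ?case by (intro add_line[OF IH])
next
  case (res_lr Cs C1 U1 x C2 U2)
  then obtain \<Pi>' L where IH: "efrege_red R \<Pi> \<phi> \<Pi>' L" "extends \<Pi> \<Pi>'"
    "\<forall>K\<in>set Cs. line_ok \<Pi> \<Pi>' L K" "efrege_size L \<le> length Cs * step_cost c n" by auto
  obtain \<Pi>'' L' where "efrege_red R \<Pi> \<phi> \<Pi>'' (L @ L')" "extends \<Pi>' \<Pi>''"
    "line_ok \<Pi> \<Pi>'' (L @ L') (C1 \<union> C2 \<union> Merged ` qvar ` U1)" "efrege_size L' \<le> step_cost c n"
    using simulate_res[OF IH(2,1) _ _ res_lr.hyps(4), of n] IH(3) res_lr by auto
  then show ?case by (intro add_line[OF IH])
qed

end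

theorem theorem6p9:
  fixes R :: "frege_rule set"
  assumes frege: "frege_system R"
  shows "\<exists>P :: nat poly. \<forall>\<Pi> \<phi> \<pi>.
           closed_pcnf \<Pi> \<phi> \<longrightarrow> lqu_plus_refutation \<Pi> \<phi> \<pi> \<longrightarrow>
           (\<exists>\<rho>. efrege_red_refutation R \<Pi> \<phi> \<rho> \<and>
                efrege_size \<rho> \<le> poly P (lqu_plus_size \<pi>))"
proof -
  obtain c where "frege_cost R c"
    using small_entailments_linear_cost[OF frege, of 25] unfolding frege_cost_def by metis
  then interpret frege_cost R c .
  \<comment> \<open>The coefficient lists spell out \<open>n * step_cost c n\<close>. The size of
    \<open>\<pi>\<close> bounds both the number of clauses and the cardinality of each, and so
    replaces both quantities.\<close>
  define P :: "nat poly" where "P = [:0, 1:] * ([:20, 20:] + [:c:] * [:20, 5:] * [:5, 10, 6:])"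
  have P: "poly P n = n * step_cost c n" for n
    by (simp add: P_def step_cost_def algebra_simps power2_eq_square)
  show ?thesis
  proof (intro exI[of _ P] allI impI)
    fix \<Pi> \<phi> \<pi> assume closed: "closed_pcnf \<Pi> \<phi>" and ref: "lqu_plus_refutation \<Pi> \<phi> \<pi>"
    let ?n = "lqu_plus_size \<pi>"
    have len: "length \<pi> \<le> ?n"
      unfolding lqu_plus_size_def by (induction \<pi>) auto
    have "card K \<le> ?n" if "K \<in> set \<pi>" for K
      using member_le_sum_list[of "1 + card K" "map (\<lambda>C. 1 + card C) \<pi>"] that
      by (simp add: lqu_plus_size_def)
    then obtain \<Pi>' L where L: "efrege_red R \<Pi> \<phi> \<Pi>' L" "\<forall>K\<in>set \<pi>. line_ok \<Pi> \<Pi>' L K"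
        "efrege_size L \<le> length \<pi> * step_cost c ?n"
      using simulate[OF closed, of \<pi> ?n] ref by (auto simp: lqu_plus_refutation_def)
    have "line_ok \<Pi> \<Pi>' L {}" using L(2) ref by (auto simp: lqu_plus_refutation_def)
    \<comment> \<open>The empty clause has no disjuncts, and the empty disjunction is
      \<open>Bot\<close> itself.\<close>
    then have "Bot \<in> set L" by (simp add: line_ok_def disjuncts_def)
    moreover have "efrege_size L \<le> poly P ?n"
      using L(3) mult_le_mono1[OF len, of "step_cost c ?n"] unfolding P by (rule le_trans)
    ultimately show "\<exists>\<rho>. efrege_red_refutation R \<Pi> \<phi> \<rho> \<and> efrege_size \<rho> \<le> poly P ?n"
      using L(1) by (auto simp: efrege_red_refutation_def)
  qed
qed

end
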